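(* Let $d\in\mathbb N$, $p>2$, $x\in\mathbb R^d$, $\varphi\in C^3(B_R(x))$ for some $R>0$, and $f\in C(B_R(x))$ with $f(x)\ge0$. Additionally assume that, if $f(x)=0$, then both $\nabla\varphi(x)\ne0$ and $\Delta_p\varphi(x)\ne0$. Let $m(\varepsilon)=\varepsilon^{\frac{2}{2+\alpha}}$ and $M(\varepsilon)=\varepsilon^{-\frac{2}{2-\alpha}}$ for $\varepsilon>0$, and let $\mathcal A^\pm_\varepsilon$ be the corresponding averaging operators (see context). Then $$\Delta_p\varphi(x)\le f(x)\qquad(\text{resp. }\Delta_p\varphi(x)\ge f(x))$$ if and only if $$\mathcal A^+_\varepsilon[\varphi](x)\le\varphi(x)+\varepsilon^2J_p(f(x))+o(\varepsilon^2)\qquad(\text{resp. }\mathcal A^+_\varepsilon[\varphi](x)\ge\varphi(x)+\varepsilon^2J_p(f(x))+o(\varepsilon^2))\quad\text{as }\varepsilon\to0^+.$$ The same result holds if $f(x)\le0$ (instead of $f(x)\ge 0$) with $\mathcal A^+_\varepsilon$ replaced by $\mathcal A^-_\varepsilon$.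
   Context: Constants: $\alpha=\frac{p-2}{p-1}$, $\beta=\frac{p-2}{p+d}$, $\gamma=\sqrt{2(p+d)}$. $B_r(x)$ is the open ball of radius $r$ centred at $x$. The $p$-Laplacian is $\Delta_p\varphi=\nabla\cdot(|\nabla\varphi|^{p-2}\nabla\varphi)$; where $\nabla\varphi\ne0$ it equals $|\nabla\varphi|^{p-2}\big((p-2)\langle D^2\varphi\frac{\nabla\varphi}{|\nabla\varphi|},\frac{\nabla\varphi}{|\nabla\varphi|}\rangle+\Delta\varphi\big)$, and $\Delta_p\varphi(x)=0$ where $\nabla\varphi(x)=0$ (as $p>2$). The signed power is $J_p(\xi)=\xi^{\frac1{p-1}}$ for $\xi\ge0$ and $J_p(\xi)=-(-\xi)^{\frac1{p-1}}$ for $\xi\le 0$. For $r>0$, $$\mathcal M_r[\varphi](x)=\beta\Big(\tfrac12\sup_{B_{\gamma r}(x)}\varphi+\tfrac12\inf_{B_{\gamma r}(x)}\varphi\Big)+(1-\beta)\frac{1}{|B_{\gamma r}(x)|}\int_{B_{\gamma r}(x)}\varphi(y)\,dy .$$ For $\varepsilon>0$, $$\mathcal A^+_\varepsilon[\varphi](x)=\inf_{c\in[m(\varepsilon),M(\varepsilon)]}\Big\{\alpha\sup_{B_{\varepsilon^2c^{1-\alpha}}(x)}\varphi+(1-\alpha)\mathcal M_{\varepsilon c^{-\alpha/2}}[\varphi](x)\Big\},$$ $$\mathcal A^-_\varepsilon[\varphi](x)=\sup_{c\in[m(\varepsilon),M(\varepsilon)]}\Big\{\alpha\inf_{B_{\varepsilon^2c^{1-\alpha}}(x)}\varphi+(1-\alpha)\mathcal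 M_{\varepsilon c^{-\alpha/2}}[\varphi](x)\Big\}.$$ These are well defined for all small enough $\varepsilon$. An inequality $a_\varepsilon\le b_\varepsilon+o(\varepsilon^2)$ as $\varepsilon\to0^+$ means $\limsup_{\varepsilon\to0^+}(a_\varepsilon-b_\varepsilon)/\varepsilon^2\le0$, and $a_\varepsilon\ge b_\varepsilon+o(\varepsilon^2)$ means $\liminf_{\varepsilon\to0^+}(a_\varepsilon-b_\varepsilon)/\varepsilon^2\ge0$. *)

theory Defs
  imports "HOL-Analysis.Analysis"
begin

text \<open>
  Euclidean space of dimension \<open>d\<close> is an arbitrary type of class \<open>euclidean_space\<close>, with
  \<open>d = DIM('a)\<close>. Functions given on a ball are total functions of which only the values on
  that ball are constrained.
\<close>

text \<open>
  \<open>C_k_on k S \<phi>\<close> is meant for open \<open>S\<close>: all partial derivatives of order at most \<open>k\<close> exist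
  and are continuous on \<open>S\<close>. No boundedness or extension to the closure of \<open>S\<close> is required.
\<close>

fun C_k_on :: "nat \<Rightarrow> 'a::euclidean_space set \<Rightarrow> ('a \<Rightarrow> real) \<Rightarrow> bool" where
  "C_k_on 0 S \<phi> \<longleftrightarrow> continuous_on S \<phi>"
| "C_k_on (Suc k) S \<phi> \<longleftrightarrow>
     (\<forall>y\<in>S. \<phi> differentiable (at y)) \<and>
     (\<forall>b\<in>Basis. C_k_on k S (\<lambda>y. frechet_derivative \<phi> (at y) b))"

definition grad :: "('a::euclidean_space \<Rightarrow> real) \<Rightarrow> 'a \<Rightarrow> 'a" where
  "grad \<phi> x = (THE D. GDERIV \<phi> x :> D)"

lemma grad_eqI:
  assumes D: "GDERIV \<phi> x :> D"
  shows "grad \<phi> x = D"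
  unfolding grad_def
proof (rule the_equality)
  fix D' assume "GDERIV \<phi> x :> D'"
  with D have "(\<lambda>h. h \<bullet> D') = (\<lambda>h. h \<bullet> D)"
    unfolding gderiv_def by (rule has_derivative_unique[rotated])
  then have "\<forall>h. h \<bullet> D' = h \<bullet> D"
    by (simp add: fun_eq_iff)
  then show "D' = D"
    by (rule vector_eq_ldot[THEN iffD1])
qed (fact D)

definition divergence :: "('a::euclidean_space \<Rightarrow> 'a) \<Rightarrow> 'a \<Rightarrow> real" where
  "divergence F x = (\<Sum>b\<in>Basis. frechet_derivative F (at x) b \<bullet> b)"

text \<open>
  For \<open>p > 2\<close> and \<open>\<phi>\<close> of class \<open>C\<^sup>2\<close> near \<open>x\<close> with \<open>grad \<phi> x = 0\<close>, the field below is
  \<open>O(norm (y - x) powr (p - 1))\<close> and so has derivative \<open>0\<close> at \<open>x\<close>: the value there is \<open>0\<close>.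
  Note that \<open>0 powr (p - 2) = 0\<close>.
\<close>

definition p_laplacian :: "real \<Rightarrow> ('a::euclidean_space \<Rightarrow> real) \<Rightarrow> 'a \<Rightarrow> real" where
  "p_laplacian p \<phi> x = divergence (\<lambda>y. norm (grad \<phi> y) powr (p - 2) *\<^sub>R grad \<phi> y) x"

definition signed_power :: "real \<Rightarrow> real \<Rightarrow> real" where
  "signed_power p \<xi> =
     (if \<xi> \<ge> 0 then \<xi> powr (1 / (p - 1)) else - ((- \<xi>) powr (1 / (p - 1))))"

definition c_alpha :: "real \<Rightarrow> real" where
  "c_alpha p = (p - 2) / (p - 1)"

definition c_beta :: "real \<Rightarrow> nat \<Rightarrow> real" where
  "c_beta p d = (p - 2) / (p + real d)"

definition c_gamma :: "real \<Rightarrow> nat \<Rightarrow> real" where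
  "c_gamma p d = sqrt (2 * (p + real d))"

definition mean_op :: "real \<Rightarrow> real \<Rightarrow> ('a::euclidean_space \<Rightarrow> real) \<Rightarrow> 'a \<Rightarrow> real" where
  "mean_op p r \<phi> x =
     (let B = ball x (c_gamma p DIM('a) * r); \<beta> = c_beta p DIM('a) in
        \<beta> * (1/2 * (SUP y\<in>B. \<phi> y) + 1/2 * (INF y\<in>B. \<phi> y))
        + (1 - \<beta>) * (1 / measure lborel B * (LINT y:B|lborel. \<phi> y)))"

text \<open>
  The suprema and infima are those of the type \<open>real\<close>, hence unspecified for unbounded sets.
  For \<open>\<phi>\<close> continuous on a neighbourhood of \<open>x\<close>, and \<open>m\<close>, \<open>M\<close> as in the theorem, all radii
  occurring below tend to \<open>0\<close> uniformly in \<open>c\<close> as \<open>\<epsilon> \<rightarrow> 0+\<close>, so all sets involved are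
  nonempty and bounded for small \<open>\<epsilon>\<close>; only such \<open>\<epsilon>\<close> matter for the asymptotic relations.
\<close>

definition avg_plus ::
    "real \<Rightarrow> (real \<Rightarrow> real) \<Rightarrow> (real \<Rightarrow> real) \<Rightarrow> real \<Rightarrow> ('a::euclidean_space \<Rightarrow> real) \<Rightarrow> 'a \<Rightarrow> real"
  where
  "avg_plus p m M \<epsilon> \<phi> x =
     (let \<alpha> = c_alpha p in
      INF c\<in>{m \<epsilon>..M \<epsilon>}.
        \<alpha> * (SUP y\<in>ball x (\<epsilon>^2 * c powr (1 - \<alpha>)). \<phi> y)
        + (1 - \<alpha>) * mean_op p (\<epsilon> * c powr (- \<alpha> / 2)) \<phi> x)"

definition avg_minus ::
    "real \<Rightarrow> (real \<Rightarrow> real) \<Rightarrow> (real \<Rightarrow> real) \<Rightarrow> real \<Rightarrow> ('a::euclidean_space \<Rightarrow> real) \<Rightarrow> 'a \<Rightarrow> real"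
  where
  "avg_minus p m M \<epsilon> \<phi> x =
     (let \<alpha> = c_alpha p in
      SUP c\<in>{m \<epsilon>..M \<epsilon>}.
        \<alpha> * (INF y\<in>ball x (\<epsilon>^2 * c powr (1 - \<alpha>)). \<phi> y)
        + (1 - \<alpha>) * mean_op p (\<epsilon> * c powr (- \<alpha> / 2)) \<phi> x)"

text \<open>\<open>a \<epsilon> \<le> b \<epsilon> + o(\<epsilon>\<^sup>2)\<close> and \<open>a \<epsilon> \<ge> b \<epsilon> + o(\<epsilon>\<^sup>2)\<close> as \<open>\<epsilon> \<rightarrow> 0+\<close>.\<close>

definition le_upto_o2 :: "(real \<Rightarrow> real) \<Rightarrow> (real \<Rightarrow> real) \<Rightarrow> bool" where
  "le_upto_o2 a b \<longleftrightarrow> Limsup (at_right 0) (\<lambda>\<epsilon>. ereal ((a \<epsilon> - b \<epsilon>) / \<epsilon>^2)) \<le> 0"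

definition ge_upto_o2 :: "(real \<Rightarrow> real) \<Rightarrow> (real \<Rightarrow> real) \<Rightarrow> bool" where
  "ge_upto_o2 a b \<longleftrightarrow> Liminf (at_right 0) (\<lambda>\<epsilon>. ereal ((a \<epsilon> - b \<epsilon>) / \<epsilon>^2)) \<ge> 0"

end

theory Submission
  imports Defs
begin

text \<open>
  Write \<open>\<alpha>\<close> for \<open>c_alpha p\<close>, \<open>g\<close> for the gradient of \<open>\<phi>\<close> at \<open>x\<close>, \<open>a = norm g\<close>, and \<open>D\<close> for the normalised
  \<open>p\<close>-Laplacian, so that the \<open>p\<close>-Laplacian \<open>\<Delta>\<close> equals \<open>a powr (p - 2) * D\<close>. The supremum over the ball of radius
  \<open>\<epsilon>\<^sup>2 * c powr (1 - \<alpha>)\<close> contributes \<open>\<phi> x + \<epsilon>\<^sup>2 * c powr (1 - \<alpha>) * a\<close> up to a small relative error.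
  If \<open>g \<noteq> 0\<close>, then the mean operator with radius parameter \<open>r = \<epsilon> * c powr (- \<alpha> / 2)\<close> is
  \<open>\<phi> x + r\<^sup>2 * D + o(r\<^sup>2)\<close> (lemma \<open>mean_op_second_order\<close>): the midrange sees the second derivative
  along the gradient, the average sees the trace of the Hessian, and the constants weigh the
  two correctly. Thus, for \<open>g \<noteq> 0\<close>, \<open>avg_plus\<close> minimises over \<open>c\<close>
  the expression
  \<open>\<phi> x + \<epsilon>\<^sup>2 * (\<alpha> * c powr (1 - \<alpha>) * a + (1 - \<alpha>) * c powr (- \<alpha>) * D)\<close>
  up to errors that amount to changing \<open>a\<close> and \<open>D\<close> by \<open>o(1)\<close>, uniformly in \<open>c\<close>.

  For \<open>\<Delta> > 0\<close>, that is \<open>g \<noteq> 0\<close> and \<open>D > 0\<close>, the weighted arithmetic-geometric mean inequality bounds the factor of \<open>\<epsilon>\<^sup>2\<close> from below by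
  \<open>a powr \<alpha> * D powr (1 - \<alpha>)\<close>, with equality for \<open>c = D / a\<close>, and this number is the signed power
  of \<open>\<Delta>\<close> (lemmas \<open>cost_ge_geometric_mean\<close>, \<open>cost_at_optimum\<close>, \<open>signed_power_p_laplacian\<close>). Because
  the errors act as perturbations of \<open>a\<close> and \<open>D\<close>, the lower bound is uniform in \<open>c\<close>, and
  \<open>avg_plus = \<phi> x + \<epsilon>\<^sup>2 * signed_power p \<Delta> + o(\<epsilon>\<^sup>2)\<close>; the equivalence follows as the signed power
  is strictly increasing.

  For \<open>\<Delta> \<le> 0\<close> an upper bound \<open>\<phi> x + o(\<epsilon>\<^sup>2)\<close> settles the comparison with a positive right-hand side.
  It is obtained from fixed controls: small ones if \<open>g \<noteq> 0\<close>, large ones if \<open>g = 0\<close>. For \<open>\<Delta> < 0\<close> small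
  controls even give a coefficient of \<open>\<epsilon>\<^sup>2\<close> below \<open>-1\<close>, which settles the case of right-hand side
  \<open>0\<close> and explains why this case requires \<open>g \<noteq> 0\<close> and \<open>\<Delta> \<noteq> 0\<close>: if \<open>\<Delta> = 0\<close> the upper bound
  \<open>\<phi> x + o(\<epsilon>\<^sup>2)\<close> alone does not decide the lower relation.
\<close>

section \<open>Second moments of a ball\<close>

text \<open>
  The second moments of the uniform distribution on a ball are determined by its symmetries.
  An exchange of two coordinates and a change of sign of one coordinate both preserve the
  Lebesgue measure and the norm; the first makes all second moments \<open>(y \<bullet> b)\<^sup>2\<close> equal, the
  second makes the mixed moments vanish. The common value then follows from the integral
  of \<open>(norm y)\<^sup>2\<close>.
\<close>

definition swap_coords :: "'a::euclidean_space \<Rightarrow> 'a \<Rightarrow> 'a \<Rightarrow> 'a" where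
  "swap_coords b c x = (\<Sum>i\<in>Basis. (x \<bullet> Transposition.transpose b c i) *\<^sub>R i)"

lemma inner_swap_coords:
  assumes "i \<in> Basis"
  shows "swap_coords b c x \<bullet> i = x \<bullet> Transposition.transpose b c i"
  using assms by (simp add: swap_coords_def inner_sum_left inner_Basis if_distrib cong: if_cong)

lemma bij_betw_transpose_Basis:
  assumes "b \<in> Basis" "c \<in> Basis"
  shows "bij_betw (Transposition.transpose b c) Basis (Basis :: 'a::euclidean_space set)"
  by (rule permutes_imp_bij[OF permutes_swap_id[OF assms]])

lemma swap_coords_measurable [measurable]: "swap_coords b c \<in> borel_measurable borel"
  unfolding swap_coords_def by measurable

lemma norm_swap_coords:
  assumes "b \<in> Basis" "c \<in> (Basis :: 'a::euclidean_space set)"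
  shows "norm (swap_coords b c x) = norm (x :: 'a)"
proof -
  have "(norm (swap_coords b c x))\<^sup>2 = (\<Sum>i\<in>Basis. (x \<bullet> Transposition.transpose b c i)\<^sup>2)"
    unfolding power2_norm_eq_inner
    by (subst euclidean_inner) (simp add: inner_swap_coords power2_eq_square)
  also have "\<dots> = (\<Sum>i\<in>Basis. (x \<bullet> i)\<^sup>2)"
    by (rule sum.reindex_bij_betw[OF bij_betw_transpose_Basis[OF assms]])
  also have "\<dots> = (norm x)\<^sup>2"
    unfolding power2_norm_eq_inner by (subst euclidean_inner) (simp add: power2_eq_square)
  finally show ?thesis by simp
qed

text \<open>
  The Lebesgue measure is characterised by its values on boxes, and an exchange of coordinates
  maps boxes to boxes while permuting the side lengths.
\<close>

lemma lborel_distr_swap_coords: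
  assumes bc: "b \<in> Basis" "c \<in> (Basis :: 'a::euclidean_space set)"
  shows "distr lborel borel (swap_coords b c) = (lborel :: 'a measure)"
proof (rule lborel_eqI[symmetric])
  fix l u :: 'a
  let ?\<tau> = "Transposition.transpose b c"
  have \<tau>: "?\<tau> i \<in> Basis" if "i \<in> Basis" for i
    using that bij_betwE[OF bij_betw_transpose_Basis[OF bc]] by blast
  have inv: "x \<bullet> ?\<tau> (?\<tau> i) = x \<bullet> i" for x i by simp
  have "swap_coords b c -` box l u = box (swap_coords b c l) (swap_coords b c u)"
  proof (intro set_eqI iffI)
    fix x assume x: "x \<in> swap_coords b c -` box l u"
    show "x \<in> box (swap_coords b c l) (swap_coords b c u)"
      unfolding mem_box
    proof
      fix i :: 'a assume i: "i \<in> Basis"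
      have "l \<bullet> ?\<tau> i < swap_coords b c x \<bullet> ?\<tau> i \<and> swap_coords b c x \<bullet> ?\<tau> i < u \<bullet> ?\<tau> i"
        using x \<tau>[OF i] unfolding vimage_eq mem_box by blast
      then show "swap_coords b c l \<bullet> i < x \<bullet> i \<and> x \<bullet> i < swap_coords b c u \<bullet> i"
        using i \<tau>[OF i] by (simp add: inner_swap_coords)
    qed
  next
    fix x assume x: "x \<in> box (swap_coords b c l) (swap_coords b c u)"
    show "x \<in> swap_coords b c -` box l u"
      unfolding vimage_eq mem_box
    proof
      fix i :: 'a assume i: "i \<in> Basis"
      have "swap_coords b c l \<bullet> ?\<tau> i < x \<bullet> ?\<tau> i \<and> x \<bullet> ?\<tau> i < swap_coords b c u \<bullet> ?\<tau> i"
        using x \<tau>[OF i] unfolding mem_box by blast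
      then show "l \<bullet> i < swap_coords b c x \<bullet> i \<and> swap_coords b c x \<bullet> i < u \<bullet> i"
        using i \<tau>[OF i] by (simp add: inner_swap_coords)
    qed
  qed
  moreover assume lu: "\<And>i. i \<in> Basis \<Longrightarrow> l \<bullet> i \<le> u \<bullet> i"
  moreover have "(\<Prod>i\<in>Basis. (swap_coords b c u - swap_coords b c l) \<bullet> i) = (\<Prod>i\<in>Basis. (u - l) \<bullet> i)"
  proof -
    have "(\<Prod>i\<in>Basis. (swap_coords b c u - swap_coords b c l) \<bullet> i) = (\<Prod>i\<in>Basis. (u - l) \<bullet> ?\<tau> i)"
      by (intro prod.cong) (simp_all add: inner_diff_left inner_swap_coords)
    also have "\<dots> = (\<Prod>i\<in>Basis. (u - l) \<bullet> i)"
      by (rule prod.reindex_bij_betw[OF bij_betw_transpose_Basis[OF bc]])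
    finally show ?thesis .
  qed
  ultimately show "emeasure (distr lborel borel (swap_coords b c)) (box l u)
      = (\<Prod>i\<in>Basis. (u - l) \<bullet> i)"
    by (simp add: emeasure_distr emeasure_lborel_box_eq inner_swap_coords \<tau> prod_nonneg)
qed simp

definition reflect_coord :: "'a::euclidean_space \<Rightarrow> 'a \<Rightarrow> 'a" where
  "reflect_coord b x = (\<Sum>i\<in>Basis. ((if i = b then - 1 else 1) * (x \<bullet> i)) *\<^sub>R i)"

lemma inner_reflect_coord:
  assumes "i \<in> Basis"
  shows "reflect_coord b x \<bullet> i = (if i = b then - (x \<bullet> i) else x \<bullet> i)"
  using assms
  by (simp add: reflect_coord_def inner_sum_left inner_Basis if_distrib[where f="\<lambda>z. _ * z"] cong: if_cong)

lemma reflect_coord_measurable [measurable]: "reflect_coord b \<in> borel_measurable borel"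
  unfolding reflect_coord_def by measurable

lemma norm_reflect_coord: "norm (reflect_coord b x) = norm (x :: 'a::euclidean_space)"
proof -
  have "(norm (reflect_coord b x))\<^sup>2 = (norm x)\<^sup>2"
    unfolding power2_norm_eq_inner
    by (subst (1 2) euclidean_inner, intro sum.cong) (simp_all add: inner_reflect_coord)
  then show ?thesis by simp
qed

lemma lborel_distr_reflect_coord:
  "distr lborel borel (reflect_coord b) = (lborel :: 'a::euclidean_space measure)"
proof -
  have "lborel = density (distr lborel borel (reflect_coord b)) 
      (\<lambda>_. \<Prod>j\<in>Basis. \<bar>if j = b then - 1 else 1 :: real\<bar>)"
    using lborel_affine_euclidean[of "\<lambda>j. if j = b then - 1 else 1" 0]
    unfolding reflect_coord_def by simp
  also have "(\<Prod>j\<in>Basis. \<bar>if j = b then - 1 else 1 :: real\<bar>) = 1"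
    by (intro prod.neutral) simp
  finally show ?thesis by (simp add: density_1)
qed

lemma set_integral_ball_isometry:
  fixes T :: "'a::euclidean_space \<Rightarrow> 'a" and f :: "'a \<Rightarrow> real"
  assumes "T \<in> borel_measurable borel" "f \<in> borel_measurable borel"
    and T: "distr lborel borel T = lborel" "\<And>x. norm (T x) = norm x"
  shows "(LINT y:ball 0 \<rho>|lborel. f (T y)) = (LINT y:ball 0 \<rho>|lborel. f y)"
proof -
  have meas: "(\<lambda>y. indicator (ball 0 \<rho>) y *\<^sub>R f y) \<in> borel_measurable borel"
    using assms(2) by (intro borel_measurable_scaleR borel_measurable_indicator) auto
  have "(LINT y:ball 0 \<rho>|lborel. f y)
      = (\<integral>y. indicator (ball 0 \<rho>) y *\<^sub>R f y \<partial>distr lborel borel T)"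
    unfolding set_lebesgue_integral_def T ..
  also have "\<dots> = (\<integral>y. indicator (ball 0 \<rho>) (T y) *\<^sub>R f (T y) \<partial>lborel)"
    using assms(1) meas by (intro integral_distr) auto
  also have "\<dots> = (LINT y:ball 0 \<rho>|lborel. f (T y))"
    unfolding set_lebesgue_integral_def
    by (intro Bochner_Integration.integral_cong) (auto simp: indicator_def T(2) dist_norm)
  finally show ?thesis ..
qed

lemma set_integrable_ball:
  fixes f :: "'a::euclidean_space \<Rightarrow> real"
  assumes "continuous_on (cball x \<rho>) f"
  shows "set_integrable lborel (ball x \<rho>) f"
proof (rule set_integrable_subset)
  show "set_integrable lborel (cball x \<rho>) f"
    unfolding set_integrable_def using assms by (intro borel_integrable_compact) auto
qed auto

lemma set_integral_ball_scale:
  fixes f :: "'a::euclidean_space \<Rightarrow> real"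
  assumes "f \<in> borel_measurable borel" and \<rho>: "\<rho> > 0"
  shows "(LINT y:ball 0 \<rho>|lborel. f y) = \<rho> ^ DIM('a) * (LINT y:ball 0 1|lborel. f (\<rho> *\<^sub>R y))"
proof -
  have meas: "(\<lambda>y. indicator (ball 0 \<rho>) y *\<^sub>R f y) \<in> borel_measurable borel"
    using assms(1) by (intro borel_measurable_scaleR borel_measurable_indicator) auto
  have "(LINT y:ball 0 \<rho>|lborel. f y) = (\<integral>y. indicator (ball 0 \<rho>) y *\<^sub>R f y
      \<partial>density (distr lborel borel (\<lambda>x. 0 + \<rho> *\<^sub>R x)) (\<lambda>_. ennreal (\<bar>\<rho>\<bar> ^ DIM('a))))"
    unfolding set_lebesgue_integral_def
    using lborel_affine[of \<rho> "0::'a"] \<rho> by simp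
  also have "\<dots> = (\<integral>y. \<rho> ^ DIM('a) * (indicator (ball 0 \<rho>) (\<rho> *\<^sub>R y) *\<^sub>R f (\<rho> *\<^sub>R y)) \<partial>lborel)"
    using \<rho> meas by (subst integral_density) (auto simp: integral_distr)
  also have "\<dots> = \<rho> ^ DIM('a) * (LINT y:ball 0 1|lborel. f (\<rho> *\<^sub>R y))"
    unfolding set_lebesgue_integral_def integral_mult_right_zero
    using \<rho> by (intro arg_cong2[where f="(*)"] Bochner_Integration.integral_cong refl)
      (auto simp: indicator_def)
  finally show ?thesis .
qed

lemma set_integral_sum_mult:
  fixes f :: "'i \<Rightarrow> 'b \<Rightarrow> real"
  assumes int: "\<And>i. set_integrable N A (f i)"
  shows "(LINT y:A|N. (\<Sum>i\<in>I. c i * f i y)) = (\<Sum>i\<in>I. c i * (LINT y:A|N. f i y))"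
proof -
  have "(LINT y:A|N. (\<Sum>i\<in>I. c i * f i y)) = (\<integral>y. (\<Sum>i\<in>I. c i * (indicator A y *\<^sub>R f i y)) \<partial>N)"
    unfolding set_lebesgue_integral_def by (simp add: sum_distrib_left mult.left_commute)
  also have "\<dots> = (\<Sum>i\<in>I. c i * (LINT y:A|N. f i y))"
    unfolding set_lebesgue_integral_def using int[unfolded set_integrable_def]
    by (subst Bochner_Integration.integral_sum) (auto intro: integrable_mult_right)
  finally show ?thesis .
qed

text \<open>
  A substitute for polar coordinates. Write \<open>I\<close> and \<open>V\<close> for the integral and the volume of the
  unit ball. By scaling, the shell between the radii \<open>s < 1\<close> and \<open>1\<close> contributes
  \<open>I * (1 - s ^ (d + 2))\<close> to the integral and \<open>V * (1 - s ^ d)\<close> to the volume, and on that shell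
  the integrand lies between \<open>s\<^sup>2\<close> and \<open>1\<close>. Dividing by \<open>1 - s\<close> and letting \<open>s\<close> tend to \<open>1\<close>
  squeezes \<open>I * (d + 2)\<close> to \<open>V * d\<close>.
\<close>

lemma set_integral_unit_ball_norm2:
  "(LINT y:ball 0 1|lborel. (norm (y::'a::euclidean_space))\<^sup>2) * real (DIM('a) + 2)
     = real DIM('a) * measure lborel (ball (0::'a) 1)"
proof -
  let ?d = "DIM('a)"
  define I where "I = (LINT y:ball 0 1|lborel. (norm (y::'a))\<^sup>2)"
  define V where "V = measure lborel (ball (0::'a) 1)"
  have bounds: "s\<^sup>2 * (V * (\<Sum>i<?d. s ^ i)) \<le> I * (\<Sum>i<?d+2. s ^ i) \<and>
       I * (\<Sum>i<?d+2. s ^ i) \<le> V * (\<Sum>i<?d. s ^ i)" if s: "0 < s" "s < 1" for s :: real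
  proof -
    define A where "A = ball (0::'a) 1 - ball 0 s"
    have Ae: "ball (0::'a) 1 = ball 0 s \<union> A" "ball 0 s \<inter> A = {}"
      using s by (auto simp: A_def)
    have A[measurable]: "A \<in> sets lborel" by (simp add: A_def)
    have Asub: "A \<subseteq> ball 0 1" by (auto simp: A_def)
    have Afin: "emeasure lborel A < \<infinity>"
      using emeasure_mono[OF Asub, of lborel] emeasure_lborel_ball_finite[of "0::'a" 1]
      by (simp add: le_less_trans)
    have int: "set_integrable lborel (ball 0 1) (\<lambda>y::'a. (norm y)\<^sup>2)"
      by (intro set_integrable_ball continuous_intros)
    have intA: "set_integrable lborel A (\<lambda>y::'a. (norm y)\<^sup>2)"
      by (rule set_integrable_subset[OF int A Asub])
    have ints: "set_integrable lborel (ball 0 s) (\<lambda>y::'a. (norm y)\<^sup>2)"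
      by (intro set_integrable_ball continuous_intros)
    have cA: "set_integrable lborel A (\<lambda>y::'a. c)" for c :: real
      using A Afin by (simp add: set_integrable_def integrable_mult_left_iff)
    have "(LINT y:ball 0 s|lborel. (norm (y::'a))\<^sup>2) = s ^ ?d * (s\<^sup>2 * I)"
      using s by (subst set_integral_ball_scale) (auto simp: I_def power_mult_distrib)
    moreover have "I = (LINT y:ball 0 s|lborel. (norm (y::'a))\<^sup>2) + (LINT y:A|lborel. (norm y)\<^sup>2)"
      unfolding I_def Ae(1) by (rule set_integral_Un[OF Ae(2) ints intA])
    ultimately have IA: "(LINT y:A|lborel. (norm y)\<^sup>2) = I * (1 - s ^ (?d + 2))"
      by (simp add: algebra_simps power_add power2_eq_square)
    have "measure lborel (ball (0::'a) 1) = measure lborel (ball (0::'a) s) + measure lborel A"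
      unfolding Ae(1) using Ae(2) Afin emeasure_lborel_ball_finite[of "0::'a" s]
      using A by (intro measure_Union) auto
    moreover have "measure lborel (ball (0::'a) s) = s ^ ?d * V"
      using s by (simp add: V_def content_ball)
    ultimately have VA: "measure lborel A = V * (1 - s ^ ?d)"
      by (simp add: V_def algebra_simps)
    have "(LINT y:A|lborel. s\<^sup>2) \<le> (LINT y:A|lborel. (norm y)\<^sup>2)"
      using s by (intro set_integral_mono cA intA) (auto simp: A_def intro!: power_mono)
    moreover have "(LINT y:A|lborel. (norm y)\<^sup>2) \<le> (LINT y:A|lborel. 1)"
      using s by (intro set_integral_mono cA intA) (auto simp: A_def intro!: power_le_one)
    moreover have cI: "(LINT y:A|lborel. c) = c * measure lborel A" for c :: real
      using Afin by (simp add: set_lebesgue_integral_def)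
    ultimately have "s\<^sup>2 * (V * (1 - s ^ ?d)) \<le> I * (1 - s ^ (?d + 2))"
      "I * (1 - s ^ (?d + 2)) \<le> V * (1 - s ^ ?d)"
      unfolding cI IA VA by auto
    \<comment> \<open>A common factor \<open>1 - s\<close> is split off from each power difference by the geometric sum.\<close>
    then have "(1 - s) * (s\<^sup>2 * (V * (\<Sum>i<?d. s ^ i))) \<le> (1 - s) * (I * (\<Sum>i<?d+2. s ^ i))"
      "(1 - s) * (I * (\<Sum>i<?d+2. s ^ i)) \<le> (1 - s) * (V * (\<Sum>i<?d. s ^ i))"
      unfolding one_diff_power_eq by (simp_all only: ac_simps)
    then show ?thesis using s by (simp only: mult_le_cancel_left_pos diff_gt_0_iff_gt)
  qed
  have ev: "\<forall>\<^sub>F s in at_left 1. 0 < s \<and> s < (1::real)"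
    using eventually_at_left_real[of 0 "1::real"] by simp
  have lim: "((\<lambda>s. c s) \<longlongrightarrow> c 1) (at_left 1)" if "isCont c 1" for c :: "real \<Rightarrow> real"
    using that by (simp add: isCont_def filterlim_at_split)
  have "1\<^sup>2 * (V * (\<Sum>i<?d. 1 ^ i)) \<le> I * (\<Sum>i<?d+2. 1 ^ i)"
    by (rule tendsto_le[OF _ lim lim]) (auto intro!: eventually_mono[OF ev] dest: bounds simp del: sum.lessThan_Suc)
  moreover have "I * (\<Sum>i<?d+2. 1 ^ i) \<le> V * (\<Sum>i<?d. 1 ^ i)"
    by (rule tendsto_le[OF _ lim lim]) (auto intro!: eventually_mono[OF ev] dest: bounds simp del: sum.lessThan_Suc)
  ultimately have "I * real (?d + 2) = real ?d * V"
    by (simp add: algebra_simps)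
  then show ?thesis by (simp add: I_def V_def)
qed

lemma set_integral_ball_coord_square:
  assumes b: "b \<in> (Basis :: 'a::euclidean_space set)" and \<rho>: "\<rho> > 0"
  shows "(LINT y:ball 0 \<rho>|lborel. (y \<bullet> b) * (y \<bullet> b))
      = \<rho>\<^sup>2 / real (DIM('a) + 2) * measure lborel (ball (0::'a) \<rho>)"
proof -
  let ?J = "\<lambda>c::'a. (LINT y:ball 0 1|lborel. (y \<bullet> c) * (y \<bullet> c))"
  have int: "set_integrable lborel (ball 0 1) (\<lambda>y::'a. (y \<bullet> c) * (y \<bullet> c))" for c
    by (intro set_integrable_ball continuous_intros)
  have eq: "?J c = ?J b" if c: "c \<in> Basis" for c
    using set_integral_ball_isometry[OF swap_coords_measurable _ lborel_distr_swap_coords[OF b c]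
        norm_swap_coords[OF b c], of "\<lambda>y. (y \<bullet> b) * (y \<bullet> b)" 1] b c
    by (simp add: inner_swap_coords)
  have n2: "(norm y)\<^sup>2 = (\<Sum>c\<in>Basis. (y \<bullet> c) * (y \<bullet> c))" for y :: 'a
    unfolding power2_norm_eq_inner by (rule euclidean_inner)
  have "(LINT y:ball 0 1|lborel. (norm (y::'a))\<^sup>2) = (\<Sum>c\<in>Basis. ?J c)"
    unfolding n2 using set_integral_sum_mult[OF int, where I = Basis and c = "\<lambda>_. 1"] by simp
  also have "\<dots> = real DIM('a) * ?J b"
    by (simp add: eq)
  finally have "real DIM('a) * (?J b * real (DIM('a) + 2))
      = real DIM('a) * measure lborel (ball (0::'a) 1)"
    using set_integral_unit_ball_norm2[where 'a='a] by (simp add: mult.assoc)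
  then have "?J b * real (DIM('a) + 2) = measure lborel (ball (0::'a) 1)"
    by simp
  then have "?J b = measure lborel (ball (0::'a) 1) / real (DIM('a) + 2)"
    by (simp add: field_simps)
  moreover have "(LINT y:ball 0 \<rho>|lborel. (y \<bullet> b) * (y \<bullet> b)) = \<rho> ^ DIM('a) * (\<rho>\<^sup>2 * ?J b)"
    using \<rho> by (subst set_integral_ball_scale)
      (auto simp: set_integral_mult_right[symmetric] power2_eq_square ac_simps simp del: set_integral_mult_right)
  ultimately show ?thesis using \<rho> by (simp add: content_ball)
qed

lemma set_integral_ball_coord_product:
  assumes "b \<in> (Basis :: 'a::euclidean_space set)" "c \<in> Basis" "b \<noteq> c"
  shows "(LINT y:ball 0 \<rho>|lborel. (y \<bullet> b) * (y \<bullet> c)) = 0"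
  using set_integral_ball_isometry[OF reflect_coord_measurable[of b] _ lborel_distr_reflect_coord
      norm_reflect_coord, where f = "\<lambda>y. (y \<bullet> b) * (y \<bullet> c)" and \<rho> = \<rho>] assms
  by (simp add: inner_reflect_coord set_lebesgue_integral_def)

lemma set_integral_ball_inner:
  "(LINT y:ball 0 \<rho>|lborel. g \<bullet> (y::'a::euclidean_space)) = 0"
proof -
  have z: "(LINT y:ball 0 \<rho>|lborel. (y::'a) \<bullet> b) = 0" if "b \<in> (Basis::'a set)" for b
    using set_integral_ball_isometry[OF reflect_coord_measurable[of b] _ lborel_distr_reflect_coord
      norm_reflect_coord, where f = "\<lambda>y. y \<bullet> b" and \<rho> = \<rho>] that
    by (simp add: inner_reflect_coord set_lebesgue_integral_def)
  have int: "set_integrable lborel (ball 0 \<rho>) (\<lambda>y::'a. y \<bullet> b)" for b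
    by (intro set_integrable_ball continuous_intros)
  have "(LINT y:ball 0 \<rho>|lborel. g \<bullet> y) = (\<Sum>b\<in>Basis. (g \<bullet> b) * (LINT y:ball 0 \<rho>|lborel. (y::'a) \<bullet> b))"
    by (subst euclidean_inner) (rule set_integral_sum_mult[OF int])
  then show ?thesis by (simp add: z)
qed

text \<open>
  The factor \<open>1 / (d + 2)\<close> found here is what the weight \<open>1 - c_beta p d\<close> of the operator is
  designed to cancel.
\<close>

lemma set_integral_ball_quadratic_form:
  fixes H :: "'a::euclidean_space \<Rightarrow> 'a"
  assumes H: "linear H" and \<rho>: "\<rho> > 0"
  shows "(LINT y:ball 0 \<rho>|lborel. H y \<bullet> y)
    = \<rho>\<^sup>2 / real (DIM('a) + 2) * (\<Sum>b\<in>Basis. H b \<bullet> b) * measure lborel (ball (0::'a) \<rho>)"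
proof -
  have int: "set_integrable lborel (ball 0 \<rho>) (\<lambda>y::'a. (y \<bullet> b) * (y \<bullet> c))" for b c
    by (intro set_integrable_ball continuous_intros)
  have Q: "H y \<bullet> y = (\<Sum>(c, b)\<in>Basis \<times> Basis. (H b \<bullet> c) * ((y \<bullet> b) * (y \<bullet> c)))" for y
  proof -
    have "H y = (\<Sum>b\<in>Basis. (y \<bullet> b) *\<^sub>R H b)"
      by (subst euclidean_representation[of y, symmetric])
        (simp only: linear_sum[OF H] linear_scale[OF H])
    then show ?thesis
      unfolding sum.cartesian_product[symmetric]
      by (subst euclidean_inner) (simp add: inner_sum_left sum_distrib_left sum_distrib_right ac_simps)
  qed
  have "(LINT y:ball 0 \<rho>|lborel. H y \<bullet> y) =
     (\<Sum>(c, b)\<in>Basis \<times> Basis. (H b \<bullet> c) * (LINT y:ball 0 \<rho>|lborel. (y \<bullet> b) * (y \<bullet> c)))"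
    unfolding Q using set_integral_sum_mult[where f = "\<lambda>(c, b) y. (y \<bullet> b) * (y \<bullet> c)"
      and I = "Basis \<times> Basis" and c = "\<lambda>(c, b). H b \<bullet> c" and N = lborel and A = "ball 0 \<rho>"] int by (simp add: case_prod_unfold)
  also have "\<dots> = (\<Sum>c\<in>Basis. \<Sum>b\<in>Basis. if b = c then
      (H c \<bullet> c) * (\<rho>\<^sup>2 / real (DIM('a) + 2) * measure lborel (ball (0::'a) \<rho>)) else 0)"
    unfolding sum.cartesian_product[symmetric] using \<rho> by (intro sum.cong refl)
      (auto simp: set_integral_ball_coord_product set_integral_ball_coord_square)
  also have "\<dots> = \<rho>\<^sup>2 / real (DIM('a) + 2) * (\<Sum>b\<in>Basis. H b \<bullet> b) * measure lborel (ball (0::'a) \<rho>)"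
    by (simp add: sum_distrib_left sum_distrib_right sum_divide_distrib ac_simps)
  finally show ?thesis .
qed

section \<open>Second-order expansion and the p-Laplacian\<close>

text \<open>
  Second-order differentiability at \<open>x\<close>, on which the expansions rest. It is phrased so
  that it gives the Taylor expansion to order two with remainder \<open>o(norm (y - x)\<^sup>2)\<close>, and so that
  it passes to \<open>- \<phi>\<close> with \<open>H\<close> replaced by \<open>- H\<close>; the case \<open>f x \<le> 0\<close> uses the latter.
\<close>

definition has_hessian :: "('a::euclidean_space \<Rightarrow> real) \<Rightarrow> 'a \<Rightarrow> ('a \<Rightarrow> 'a) \<Rightarrow> bool" where
  "has_hessian \<phi> x H \<longleftrightarrow>
     (\<forall>\<^sub>F y in nhds x. GDERIV \<phi> y :> grad \<phi> y) \<and> (grad \<phi> has_derivative H) (at x)"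

lemma C_3_imp_has_hessian:
  assumes C: "C_k_on 3 (ball x R) \<phi>" and R: "R > 0"
  shows "\<exists>H. has_hessian \<phi> x H"
proof -
  define G where "G y = (\<Sum>b\<in>Basis. frechet_derivative \<phi> (at y) b *\<^sub>R b)" for y
  have C': "\<And>y. y \<in> ball x R \<Longrightarrow> \<phi> differentiable (at y)"
    "\<And>b y. b \<in> Basis \<Longrightarrow> y \<in> ball x R \<Longrightarrow> (\<lambda>y. frechet_derivative \<phi> (at y) b) differentiable (at y)"
    using C by (auto simp: numeral_3_eq_3)
  have G: "GDERIV \<phi> y :> G y" if y: "y \<in> ball x R" for y
  proof -
    let ?D = "frechet_derivative \<phi> (at y)"
    have D: "(\<phi> has_derivative ?D) (at y)"
      using C'(1)[OF y] by (simp add: frechet_derivative_works)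
    then interpret D: bounded_linear ?D by (rule has_derivative_bounded_linear)
    have "?D h = h \<bullet> G y" for h
    proof -
      have "?D h = ?D (\<Sum>b\<in>Basis. (h \<bullet> b) *\<^sub>R b)" by (simp add: euclidean_representation)
      also have "\<dots> = h \<bullet> G y" by (simp add: D.sum D.scale G_def inner_sum_right mult.commute)
      finally show ?thesis .
    qed
    then have "?D = (\<lambda>h. h \<bullet> G y)" by (rule ext)
    with D show ?thesis unfolding gderiv_def by simp
  qed
  then have eq: "grad \<phi> y = G y" if "y \<in> ball x R" for y
    using that by (blast intro: grad_eqI)
  have "G differentiable (at x)"
    unfolding G_def using C'(2) R by (intro differentiable_sum differentiable_scaleR) auto
  then obtain H where "(G has_derivative H) (at x)"
    unfolding differentiable_def by blast
  then have "(grad \<phi> has_derivative H) (at x)"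
    by (rule has_derivative_transform_within_open[of _ _ _ _ "ball x R"]) (use R eq in auto)
  moreover have "\<forall>\<^sub>F y in nhds x. GDERIV \<phi> y :> grad \<phi> y"
    using eventually_nhds_in_open[of "ball x R" x] R by (auto elim!: eventually_mono simp: eq G)
  ultimately show ?thesis unfolding has_hessian_def by blast
qed

lemma has_hessian_uminus:
  assumes "has_hessian \<phi> x H"
  shows "grad (\<lambda>y. - \<phi> y) x = - grad \<phi> x" "has_hessian (\<lambda>y. - \<phi> y) x (\<lambda>h. - H h)"
proof -
  have ev: "\<forall>\<^sub>F y in nhds x. GDERIV \<phi> y :> grad \<phi> y" and D: "(grad \<phi> has_derivative H) (at x)"
    using assms by (auto simp: has_hessian_def)
  have G: "GDERIV (\<lambda>y. - \<phi> y) y :> - grad \<phi> y" "grad (\<lambda>y. - \<phi> y) y = - grad \<phi> y"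
    if "GDERIV \<phi> y :> grad \<phi> y" for y
    using GDERIV_minus[OF that] by (auto intro: grad_eqI)
  have ev': "\<forall>\<^sub>F y in nhds x. - grad \<phi> y = grad (\<lambda>y. - \<phi> y) y"
    using ev by eventually_elim (simp add: G)
  show 1: "grad (\<lambda>y. - \<phi> y) x = - grad \<phi> x"
    using eventually_nhds_x_imp_x[OF ev'] by simp
  have "((\<lambda>y. - grad \<phi> y) has_derivative (\<lambda>h. - H h)) (at x)"
    using D by (rule has_derivative_minus)
  then have "(grad (\<lambda>y. - \<phi> y) has_derivative (\<lambda>h. - H h)) (at x)"
    by (rule has_derivative_transform_eventually)
      (use ev' 1 in \<open>auto intro: eventually_nhds_conv_at[THEN iffD1, THEN conjunct1]\<close>)
  moreover have "\<forall>\<^sub>F y in nhds x. GDERIV (\<lambda>y. - \<phi> y) y :> grad (\<lambda>y. - \<phi> y) y"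
    using ev by eventually_elim (simp add: G)
  ultimately show "has_hessian (\<lambda>y. - \<phi> y) x (\<lambda>h. - H h)" by (simp add: has_hessian_def)
qed

lemma has_hessian_gderiv:
  assumes "has_hessian \<phi> x H"
  shows "GDERIV \<phi> x :> grad \<phi> x"
  using assms eventually_nhds_x_imp_x unfolding has_hessian_def by blast

lemma has_hessian_linear:
  assumes "has_hessian \<phi> x H"
  shows "bounded_linear H"
  using assms has_derivative_bounded_linear unfolding has_hessian_def by blast

text \<open>
  Pointwise estimates near \<open>x\<close> become estimates on all sufficiently small balls, which is the
  form in which suprema and means consume them.
\<close>

lemma eventually_at_right_cball:
  fixes x :: "'a::metric_space"
  assumes "\<forall>\<^sub>F y in nhds x. P y"
  shows "\<forall>\<^sub>F \<rho> in at_right 0. \<forall>y\<in>cball x \<rho>. P y"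
proof -
  obtain d where "d > 0" "\<And>y. dist y x < d \<Longrightarrow> P y"
    using assms unfolding eventually_nhds_metric by blast
  then show ?thesis
    by (intro eventually_at_rightI[of 0 d]) (auto simp: dist_commute)
qed

lemma has_hessian_continuous:
  assumes "has_hessian \<phi> x H"
  shows "\<forall>\<^sub>F \<rho> in at_right 0. continuous_on (cball x \<rho>) \<phi>"
proof -
  have "\<forall>\<^sub>F y in nhds x. isCont \<phi> y"
    using assms unfolding has_hessian_def gderiv_def
    by (auto elim!: eventually_mono dest: has_derivative_continuous)
  from eventually_at_right_cball[OF this] show ?thesis
    by eventually_elim (auto intro: continuous_at_imp_continuous_on)
qed

lemma has_hessian_first_order:
  assumes "has_hessian \<phi> x H" and "e > 0"
  shows "\<forall>\<^sub>F y in nhds x. \<bar>\<phi> y - \<phi> x - grad \<phi> x \<bullet> (y - x)\<bar> \<le> e * norm (y - x)"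
proof -
  have "(\<phi> has_derivative (\<lambda>h. h \<bullet> grad \<phi> x)) (at x)"
    using has_hessian_gderiv[OF assms(1)] by (simp add: gderiv_def)
  then show ?thesis using assms(2)
    unfolding has_derivative_at_alt eventually_nhds_metric dist_norm real_norm_def
    by (auto simp: inner_commute)
qed

text \<open>
  The function \<open>t \<mapsto> \<phi> (x + t h)\<close> minus its quadratic approximation has derivative
  \<open>(grad \<phi> (x + t h) - grad \<phi> x - t H h) \<bullet> h\<close>, which is \<open>o((norm h)\<^sup>2)\<close> by differentiability of
  the gradient at \<open>x\<close>; the mean value theorem transfers this bound to the function itself.
\<close>

lemma has_hessian_taylor:
  assumes hess: "has_hessian \<phi> x H" and e: "e > 0"
  shows "\<forall>\<^sub>F y in nhds x.
    \<bar>\<phi> y - \<phi> x - grad \<phi> x \<bullet> (y - x) - H (y - x) \<bullet> (y - x) / 2\<bar> \<le> e * (norm (y - x))\<^sup>2"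
proof -
  interpret H: bounded_linear H using has_hessian_linear[OF hess] .
  have D: "(grad \<phi> has_derivative H) (at x)" using hess by (simp add: has_hessian_def)
  obtain d1 where d1: "d1 > 0" "\<And>y. norm (y - x) < d1 \<Longrightarrow> GDERIV \<phi> y :> grad \<phi> y"
    using hess unfolding has_hessian_def eventually_nhds_metric dist_norm by blast
  obtain d2 where d2: "d2 > 0" "\<And>y. norm (y - x) < d2 \<Longrightarrow>
      norm (grad \<phi> y - grad \<phi> x - H (y - x)) \<le> e * norm (y - x)"
    using D e unfolding has_derivative_at_alt by blast
  have "\<bar>\<phi> y - \<phi> x - grad \<phi> x \<bullet> (y - x) - H (y - x) \<bullet> (y - x) / 2\<bar> \<le> e * (norm (y - x))\<^sup>2"
    if y: "norm (y - x) < min d1 d2" for y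
  proof -
    define h where "h = y - x"
    define w where "w t = \<phi> (x + t *\<^sub>R h) - t * (grad \<phi> x \<bullet> h) - t\<^sup>2 * (H h \<bullet> h) / 2" for t :: real
    define w' where "w' t = (grad \<phi> (x + t *\<^sub>R h) - grad \<phi> x - H (t *\<^sub>R h)) \<bullet> h" for t :: real
    have small: "norm (t *\<^sub>R h) \<le> norm h" if "0 \<le> t" "t \<le> 1" for t
      using that by (simp add: mult_left_le_one_le)
    have der: "(w has_real_derivative w' t) (at t)" if t: "0 \<le> t" "t \<le> 1" for t
    proof -
      have "GDERIV \<phi> (x + t *\<^sub>R h) :> grad \<phi> (x + t *\<^sub>R h)"
        using small[OF t] y by (intro d1) (simp add: h_def)
      then have "(\<phi> has_derivative (\<lambda>k. k \<bullet> grad \<phi> (x + t *\<^sub>R h))) (at (x + t *\<^sub>R h))"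
        by (simp add: gderiv_def)
      then have "((\<lambda>t. \<phi> (x + t *\<^sub>R h)) has_derivative (\<lambda>s. (s *\<^sub>R h) \<bullet> grad \<phi> (x + t *\<^sub>R h))) (at t)"
        by (rule has_derivative_compose[rotated]) (auto intro!: derivative_eq_intros)
      then have "((\<lambda>t. \<phi> (x + t *\<^sub>R h)) has_real_derivative (h \<bullet> grad \<phi> (x + t *\<^sub>R h))) (at t)"
        by (simp add: has_field_derivative_def mult_commute_abs)
      then show ?thesis unfolding w_def w'_def
        by (auto intro!: derivative_eq_intros simp: H.scale inner_diff_left inner_diff_right inner_commute)
    qed
    obtain t where t: "0 < t" "t < 1" "w 1 - w 0 = (1 - 0) * w' t"
      using MVT2[of 0 1 w w'] der by auto
    have "\<bar>w' t\<bar> \<le> norm (grad \<phi> (x + t *\<^sub>R h) - grad \<phi> x - H (t *\<^sub>R h)) * norm h"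
      unfolding w'_def by (rule Cauchy_Schwarz_ineq2)
    also have "\<dots> \<le> (e * norm h) * norm h"
    proof (rule mult_right_mono)
      have "norm (grad \<phi> (x + t *\<^sub>R h) - grad \<phi> x - H (t *\<^sub>R h)) \<le> e * norm (t *\<^sub>R h)"
        using d2(2)[of "x + t *\<^sub>R h"] small[of t] t y by (simp add: h_def)
      also have "\<dots> \<le> e * norm h" using small[of t] t e by (intro mult_left_mono) auto
      finally show "norm (grad \<phi> (x + t *\<^sub>R h) - grad \<phi> x - H (t *\<^sub>R h)) \<le> e * norm h" .
    qed simp
    finally have "\<bar>w 1 - w 0\<bar> \<le> e * (norm h)\<^sup>2" using t by (simp add: power2_eq_square mult.assoc)
    then show ?thesis by (simp add: w_def h_def algebra_simps)
  qed
  then show ?thesis unfolding eventually_nhds_metric dist_norm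
    using d1(1) d2(1) by (intro exI[of _ "min d1 d2"]) auto
qed

text \<open>
  The divergence form agrees with the non-divergence form also where the gradient vanishes. There
  the field has derivative \<open>0\<close>, because it is bounded by \<open>o(1) * norm (grad \<phi> y)\<close> with
  \<open>norm (grad \<phi> y) = O(norm (y - x))\<close>, and the right-hand side is \<open>0\<close> because
  \<open>0 powr (p - 2) = 0\<close>.
\<close>

lemma p_laplacian_eq:
  assumes hess: "has_hessian \<phi> x H" and p: "p > 2"
  shows "p_laplacian p \<phi> x = norm (grad \<phi> x) powr (p - 2) *
    ((p - 2) * (H (sgn (grad \<phi> x)) \<bullet> sgn (grad \<phi> x)) + (\<Sum>b\<in>Basis. H b \<bullet> b))"
proof -
  interpret H: bounded_linear H using has_hessian_linear[OF hess] .
  have D: "(grad \<phi> has_derivative H) (at x)" using hess by (simp add: has_hessian_def)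
  define F where "F y = norm (grad \<phi> y) powr (p - 2) *\<^sub>R grad \<phi> y" for y
  define g where "g = grad \<phi> x"
  have pl: "p_laplacian p \<phi> x = (\<Sum>b\<in>Basis. F' b \<bullet> b)" if "(F has_derivative F') (at x)" for F'
    using frechet_derivative_at[OF that] unfolding p_laplacian_def divergence_def F_def by simp
  show ?thesis
  proof (cases "g = 0")
    case True
    have "isCont (grad \<phi>) x" using D by (rule has_derivative_continuous)
    then have "((\<lambda>y. norm (grad \<phi> y) powr (p - 2)) \<longlongrightarrow> 0 powr (p - 2)) (at x)"
      using True p unfolding g_def isCont_def
      by (intro tendsto_powr2) (auto intro: tendsto_eq_intros)
    then have lim: "((\<lambda>y. norm (grad \<phi> y) powr (p - 2)) \<longlongrightarrow> 0) (at x)" using p by simp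
    have "(F has_derivative (\<lambda>h. 0)) (at x)"
      unfolding has_derivative_at_alt
    proof (intro conjI allI impI)
      fix e :: real assume e: "e > 0"
      obtain K where K: "K > 0" "\<And>h. norm (H h) \<le> norm h * K" using H.pos_bounded by blast
      obtain d1 where d1: "d1 > 0" "\<And>y. norm (y - x) < d1 \<Longrightarrow>
          norm (grad \<phi> y - grad \<phi> x - H (y - x)) \<le> 1 * norm (y - x)"
        using D zero_less_one unfolding has_derivative_at_alt by blast
      \<comment> \<open>The gradient near \<open>x\<close> is at most \<open>(K + 1) * norm (y - x)\<close>.\<close>
      have "\<forall>\<^sub>F y in at x. norm (grad \<phi> y) powr (p - 2) < e / (K + 1)"
        using lim e K(1) by (intro order_tendstoD(2)) auto
      then obtain d2 where d2: "d2 > 0" "\<And>y. y \<noteq> x \<Longrightarrow> norm (y - x) < d2 \<Longrightarrow>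
          norm (grad \<phi> y) powr (p - 2) < e / (K + 1)"
        unfolding eventually_at dist_norm by blast
      have "norm (F y - F x - 0) \<le> e * norm (y - x)" if y: "norm (y - x) < min d1 d2" for y
      proof (cases "y = x")
        case False
        have "norm (grad \<phi> y) \<le> norm (grad \<phi> y - grad \<phi> x - H (y - x)) + norm (H (y - x))"
          using True norm_triangle_ineq[of "grad \<phi> y - H (y - x)" "H (y - x)"] by (simp add: g_def)
        also have "\<dots> \<le> (K + 1) * norm (y - x)"
          using d1(2)[of y] K(2)[of "y - x"] y by (simp add: algebra_simps)
        finally have "norm (grad \<phi> y) powr (p - 2) * norm (grad \<phi> y)
            \<le> (e / (K + 1)) * ((K + 1) * norm (y - x))"
          using d2(2)[OF False] y e K(1) by (intro mult_mono) auto
        moreover have "norm (F y - F x - 0) = norm (grad \<phi> y) powr (p - 2) * norm (grad \<phi> y)"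
          using True by (simp add: F_def g_def)
        ultimately show ?thesis using K(1) by simp
      qed simp
      then show "\<exists>d>0. \<forall>y. norm (y - x) < d \<longrightarrow> norm (F y - F x - 0) \<le> e * norm (y - x)"
        using d1(1) d2(1) by (intro exI[of _ "min d1 d2"]) auto
    qed simp
    from pl[OF this] show ?thesis using True p by (simp add: g_def)
  next
    case False
    have "((\<lambda>y. norm (grad \<phi> y)) has_derivative (\<lambda>h. H h \<bullet> sgn g)) (at x)"
      using has_derivative_compose[OF D has_derivative_norm[OF False[unfolded g_def]]]
      by (simp add: g_def)
    then have "((\<lambda>y. norm (grad \<phi> y) powr (p - 2)) has_derivative
        (\<lambda>h. norm g powr (p - 2) * ((H h \<bullet> sgn g) * (p - 2) / norm g))) (at x)"
      using False by (auto intro!: derivative_eq_intros simp: g_def)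
    then have "(F has_derivative (\<lambda>h. norm g powr (p - 2) *\<^sub>R H h +
        (norm g powr (p - 2) * ((H h \<bullet> sgn g) * (p - 2) / norm g)) *\<^sub>R g)) (at x)"
      unfolding F_def g_def using D by (rule has_derivative_scaleR)
    from pl[OF this] have "p_laplacian p \<phi> x = (\<Sum>b\<in>Basis. norm g powr (p - 2) * (H b \<bullet> b) +
        norm g powr (p - 2) * ((p - 2) * ((H b \<bullet> sgn g) * (sgn g \<bullet> b))))"
      by (simp add: inner_add_left sgn_div_norm field_simps)
    also have "\<dots> = norm g powr (p - 2) * ((p - 2) * (\<Sum>b\<in>Basis. (H b \<bullet> sgn g) * (sgn g \<bullet> b)) 
        + (\<Sum>b\<in>Basis. H b \<bullet> b))"
      by (simp add: sum.distrib sum_distrib_left distrib_left)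
    also have "(\<Sum>b\<in>Basis. (H b \<bullet> sgn g) * (sgn g \<bullet> b)) = H (sgn g) \<bullet> sgn g"
    proof -
      have "H (sgn g) = H (\<Sum>b\<in>Basis. (sgn g \<bullet> b) *\<^sub>R b)" by (simp only: euclidean_representation)
      then show ?thesis by (simp add: H.sum H.scale inner_sum_left mult.commute)
    qed
    finally show ?thesis by (simp add: g_def)
  qed
qed

section \<open>Suprema, infima and means over small balls\<close>

lemma INF_eq_minus_SUP: "(INF y\<in>A. \<phi> y) = - (SUP y\<in>A. - \<phi> y :: real)"
  by (simp add: Inf_real_def image_image)

lemma SUP_ball_le:
  fixes \<phi> :: "'a::euclidean_space \<Rightarrow> real"
  assumes "\<rho> > 0" "\<And>y. y \<in> ball x \<rho> \<Longrightarrow> \<phi> y \<le> K"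
  shows "(SUP y\<in>ball x \<rho>. \<phi> y) \<le> K"
  using assms by (intro cSUP_least) auto

text \<open>
  The maximising point of the linear part lies on the sphere, while the suprema are taken over
  open balls; continuity on the closed ball bridges the gap.
\<close>

lemma le_SUP_ball:
  fixes \<phi> :: "'a::euclidean_space \<Rightarrow> real"
  assumes cont: "continuous_on (cball x \<rho>) \<phi>" and \<rho>: "\<rho> > 0" and y: "y \<in> cball x \<rho>"
  shows "\<phi> y \<le> (SUP y\<in>ball x \<rho>. \<phi> y)"
proof -
  have "bounded (\<phi> ` cball x \<rho>)"
    by (intro compact_imp_bounded compact_continuous_image cont) simp
  then have "bdd_above (\<phi> ` ball x \<rho>)"
    by (meson ball_subset_cball bdd_above_mono bounded_imp_bdd_above image_mono)
  then have "\<phi> z \<le> (SUP y\<in>ball x \<rho>. \<phi> y)" if "z \<in> ball x \<rho>" for z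
    using that by (intro cSUP_upper)
  then show ?thesis
    using continuous_le_on_closure[of "ball x \<rho>" \<phi> y] cont y \<rho> by simp
qed

lemma linear_bound:
  assumes "bounded_linear H"
  obtains N where "N > 0" "\<And>h. norm (H h) \<le> N * norm h" 
  using bounded_linear.pos_bounded[OF assms] by (metis mult.commute)

lemma SUP_ball_first_order_le:
  assumes hess: "has_hessian \<phi> x H" and e: "e > 0"
  shows "\<forall>\<^sub>F \<rho> in at_right 0. (SUP y\<in>ball x \<rho>. \<phi> y) \<le> \<phi> x + \<rho> * (norm (grad \<phi> x) + e)"
  using eventually_at_right_cball[OF has_hessian_first_order[OF hess e]] eventually_at_right_less
proof eventually_elim
  case (elim \<rho>)
  show ?case
  proof (rule SUP_ball_le)
    fix y assume y: "y \<in> ball x \<rho>"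
    have n: "norm (y - x) \<le> \<rho>" using y by (simp add: dist_norm norm_minus_commute)
    have "\<phi> y \<le> \<phi> x + grad \<phi> x \<bullet> (y - x) + e * norm (y - x)" using bspec[OF elim(1), of y] y by auto
    also have "\<dots> \<le> \<phi> x + norm (grad \<phi> x) * norm (y - x) + e * norm (y - x)"
      using norm_cauchy_schwarz[of "grad \<phi> x" "y - x"] by simp
    also have "\<dots> = \<phi> x + norm (y - x) * (norm (grad \<phi> x) + e)" by (simp add: algebra_simps)
    also have "\<dots> \<le> \<phi> x + \<rho> * (norm (grad \<phi> x) + e)"
      using n e by (simp add: mult_right_mono)
    finally show "\<phi> y \<le> \<phi> x + \<rho> * (norm (grad \<phi> x) + e)" .
  qed (use elim in auto)
qed

lemma inner_sgn_self: "g \<bullet> sgn g = norm (g :: 'a::real_inner)"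
  by (cases "g = 0") (simp_all add: sgn_div_norm power2_norm_eq_inner[symmetric] power2_eq_square)

lemma norm_sgn_le_1: "norm (sgn g :: 'a::real_normed_vector) \<le> 1"
  by (simp add: norm_sgn)

lemma SUP_ball_first_order_ge:
  assumes hess: "has_hessian \<phi> x H" and e: "e > 0"
  shows "\<forall>\<^sub>F \<rho> in at_right 0. (SUP y\<in>ball x \<rho>. \<phi> y) \<ge> \<phi> x + \<rho> * (norm (grad \<phi> x) - e)"
  using eventually_at_right_cball[OF has_hessian_first_order[OF hess e]] has_hessian_continuous[OF hess]
    eventually_at_right_less
proof eventually_elim
  case (elim \<rho>)
  define y where "y = x + \<rho> *\<^sub>R sgn (grad \<phi> x)"
  have n: "norm (y - x) \<le> \<rho>" using elim by (simp add: y_def norm_sgn)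
  then have y: "y \<in> cball x \<rho>" by (simp add: dist_norm norm_minus_commute)
  have "\<phi> x + grad \<phi> x \<bullet> (y - x) - e * norm (y - x) \<le> \<phi> y" using elim(1) y by fastforce
  moreover have "grad \<phi> x \<bullet> (y - x) = \<rho> * norm (grad \<phi> x)" by (simp add: y_def inner_sgn_self)
  moreover have "e * norm (y - x) \<le> e * \<rho>" using n e by simp
  ultimately show ?case
    using le_SUP_ball[OF elim(2) elim(3) y] by (simp add: algebra_simps)
qed

text \<open>
  Write \<open>u = v + k\<close> with \<open>v = sgn g\<close>. Moving away from \<open>v\<close> inside the unit ball costs,
  after division by \<open>\<rho>\<close>, at least \<open>norm g * (norm k)\<^sup>2 / 2\<close> in the linear term, and it gains at most \<open>\<rho> * N * norm k\<close> in the
  quadratic term. Hence \<open>v\<close> is optimal up to a gain of order \<open>\<rho>\<^sup>3\<close>.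
\<close>

lemma linear_plus_quadratic_on_ball_le:
  fixes H :: "'a::euclidean_space \<Rightarrow> 'a"
  assumes H: "bounded_linear H" and N: "\<And>h. norm (H h) \<le> N * norm h"
    and g: "g \<noteq> 0" and u: "norm u \<le> 1" and \<rho>: "\<rho> > 0"
  shows "\<rho> * (g \<bullet> u) + \<rho>\<^sup>2 * (H u \<bullet> u) / 2
     \<le> \<rho> * norm g + \<rho>\<^sup>2 * (H (sgn g) \<bullet> sgn g) / 2 + \<rho>\<^sup>2 * (\<rho> * N\<^sup>2 / (2 * norm g))"
proof -
  interpret H: bounded_linear H by fact
  define v k where "v = sgn g" and "k = u - v"
  define a t where "a = norm g" and "t = norm k"
  have a: "a > 0" using g by (simp add: a_def)
  have v: "norm v = 1" using g by (simp add: v_def norm_sgn)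
  have gv: "g = a *\<^sub>R v" using g by (simp add: a_def v_def sgn_div_norm)
  have "t\<^sup>2 = (norm u)\<^sup>2 + (norm v)\<^sup>2 - 2 * (v \<bullet> u)"
    by (simp add: t_def k_def power2_norm_eq_inner inner_diff_left inner_diff_right inner_commute)
  moreover have "(norm u)\<^sup>2 \<le> 1" using u by (simp add: power_le_one)
  ultimately have "v \<bullet> u \<le> 1 - t\<^sup>2 / 2" using v by (simp add: field_simps)
  then have gu: "g \<bullet> u \<le> a * (1 - t\<^sup>2 / 2)" using a by (simp add: gv)
  have "H u \<bullet> u - H v \<bullet> v = H k \<bullet> u + H v \<bullet> k"
    by (simp add: k_def H.diff inner_diff_left inner_diff_right)
  also have "\<dots> \<le> norm (H k) * norm u + norm (H v) * norm k"
    by (intro add_mono norm_cauchy_schwarz)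
  also have "\<dots> \<le> (N * t) * 1 + (N * 1) * t"
    using N[of k] N[of v] u v order_trans[OF norm_ge_zero N[of k]] order_trans[OF norm_ge_zero N[of v]]
    by (intro add_mono mult_mono) (auto simp: t_def)
  finally have Hu: "H u \<bullet> u \<le> H v \<bullet> v + 2 * N * t" by simp
  \<comment> \<open>The loss quadratic in \<open>t\<close> absorbs the gain linear in \<open>t\<close> after completing the square.\<close>
  have "0 \<le> (a * t - \<rho> * N)\<^sup>2 / (2 * a)" using a by simp
  also have "\<dots> = a * t\<^sup>2 / 2 - \<rho> * N * t + \<rho>\<^sup>2 * N\<^sup>2 / (2 * a)"
    using a by (simp add: power2_eq_square field_simps)
  finally have "\<rho> * 0 \<le> \<rho> * (a * t\<^sup>2 / 2 - \<rho> * N * t + \<rho>\<^sup>2 * N\<^sup>2 / (2 * a))"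
    using \<rho> by (intro mult_left_mono) auto
  moreover have "\<rho> * (g \<bullet> u) \<le> \<rho> * (a * (1 - t\<^sup>2 / 2))" using gu \<rho> by simp
  moreover have "\<rho>\<^sup>2 * (H u \<bullet> u) / 2 \<le> \<rho>\<^sup>2 * (H v \<bullet> v + 2 * N * t) / 2" using Hu \<rho> by simp
  ultimately show ?thesis
    by (simp add: a_def[symmetric] v_def[symmetric] power2_eq_square algebra_simps)
qed

lemma SUP_ball_second_order:
  assumes hess: "has_hessian \<phi> x H" and g: "grad \<phi> x \<noteq> 0" and e: "e > 0"
  shows "\<forall>\<^sub>F \<rho> in at_right 0. \<bar>(SUP y\<in>ball x \<rho>. \<phi> y) -
    (\<phi> x + \<rho> * norm (grad \<phi> x) + \<rho>\<^sup>2 * (H (sgn (grad \<phi> x)) \<bullet> sgn (grad \<phi> x)) / 2)\<bar> \<le> e * \<rho>\<^sup>2"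
proof -
  interpret H: bounded_linear H using has_hessian_linear[OF hess] .
  define g where "g = grad \<phi> x"
  obtain N where N: "N > 0" "\<And>h. norm (H h) \<le> N * norm h"
    using linear_bound[OF has_hessian_linear[OF hess]] by blast
  have e2: "e / 2 > 0" using e by simp
  have "((\<lambda>\<rho>. \<rho> * N\<^sup>2 / (2 * norm g)) \<longlongrightarrow> 0 * N\<^sup>2 / (2 * norm g)) (at_right 0)"
    using g by (intro tendsto_intros) (auto simp: g_def)
  then have "\<forall>\<^sub>F \<rho> in at_right 0. \<rho> * N\<^sup>2 / (2 * norm g) < e / 2"
    using e2 by (intro order_tendstoD(2)) auto
  then show ?thesis
    using eventually_at_right_cball[OF has_hessian_taylor[OF hess e2]] has_hessian_continuous[OF hess]
      eventually_at_right_less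
  proof eventually_elim
    case (elim \<rho>)
    let ?q = "H (sgn g) \<bullet> sgn g"
    have tay: "\<bar>\<phi> (x + \<rho> *\<^sub>R u) - (\<phi> x + \<rho> * (g \<bullet> u) + \<rho>\<^sup>2 * (H u \<bullet> u) / 2)\<bar> \<le> e / 2 * \<rho>\<^sup>2"
      if u: "norm u \<le> 1" for u
    proof -
      have n: "norm (\<rho> *\<^sub>R u) \<le> \<rho>" using u elim by (simp add: mult_left_le)
      then have "x + \<rho> *\<^sub>R u \<in> cball x \<rho>" by (simp add: dist_norm)
      then have "\<bar>\<phi> (x + \<rho> *\<^sub>R u) - \<phi> x - g \<bullet> (\<rho> *\<^sub>R u) - H (\<rho> *\<^sub>R u) \<bullet> (\<rho> *\<^sub>R u) / 2\<bar>
          \<le> e / 2 * (norm (\<rho> *\<^sub>R u))\<^sup>2"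
        using elim(2) unfolding g_def by fastforce
      also have "\<dots> \<le> e / 2 * \<rho>\<^sup>2" using n e by (intro mult_left_mono power_mono) auto
      finally show ?thesis by (simp add: H.scale power2_eq_square algebra_simps)
    qed
    have "(SUP y\<in>ball x \<rho>. \<phi> y) \<le> \<phi> x + \<rho> * norm g + \<rho>\<^sup>2 * ?q / 2 + e * \<rho>\<^sup>2"
    proof (rule SUP_ball_le)
      fix y assume y: "y \<in> ball x \<rho>"
      define u where "u = (1 / \<rho>) *\<^sub>R (y - x)"
      have u: "norm u \<le> 1" using y elim by (simp add: u_def dist_norm norm_minus_commute)
      have "\<phi> y = \<phi> (x + \<rho> *\<^sub>R u)" using elim by (simp add: u_def)
      also have "\<dots> \<le> \<phi> x + \<rho> * (g \<bullet> u) + \<rho>\<^sup>2 * (H u \<bullet> u) / 2 + e / 2 * \<rho>\<^sup>2"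
        using tay[OF u] by linarith
      also have "\<dots> \<le> \<phi> x + \<rho> * norm g + \<rho>\<^sup>2 * ?q / 2 + \<rho>\<^sup>2 * (\<rho> * N\<^sup>2 / (2 * norm g)) + e / 2 * \<rho>\<^sup>2"
        using linear_plus_quadratic_on_ball_le[OF H.bounded_linear_axioms N(2) _ u elim(4), of g] g
        by (simp add: g_def)
      also have "\<rho>\<^sup>2 * (\<rho> * N\<^sup>2 / (2 * norm g)) \<le> \<rho>\<^sup>2 * (e / 2)"
        using elim by (intro mult_left_mono) auto
      finally show "\<phi> y \<le> \<phi> x + \<rho> * norm g + \<rho>\<^sup>2 * ?q / 2 + e * \<rho>\<^sup>2" by simp
    qed (use elim in auto)
    moreover have "\<phi> x + \<rho> * norm g + \<rho>\<^sup>2 * ?q / 2 - e * \<rho>\<^sup>2 \<le> (SUP y\<in>ball x \<rho>. \<phi> y)"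
    proof -
      have "x + \<rho> *\<^sub>R sgn g \<in> cball x \<rho>" using elim by (simp add: dist_norm norm_sgn)
      note le_SUP_ball[OF elim(3,4) this]
      moreover have "e / 2 * \<rho>\<^sup>2 \<le> e * \<rho>\<^sup>2" using e by simp
      ultimately show ?thesis
        using tay[OF norm_sgn_le_1[of g]] unfolding inner_sgn_self abs_le_iff by linarith
    qed
    ultimately show ?case by (simp add: g_def abs_le_iff)
  qed
qed

text \<open>
  In the average of supremum and infimum the first-order terms cancel, and what remains is the
  second derivative in the direction of the gradient.
\<close>

lemma midrange_ball_second_order:
  assumes hess: "has_hessian \<phi> x H" and g: "grad \<phi> x \<noteq> 0" and e: "e > 0"
  shows "\<forall>\<^sub>F \<rho> in at_right 0. \<bar>1/2 * (SUP y\<in>ball x \<rho>. \<phi> y) + 1/2 * (INF y\<in>ball x \<rho>. \<phi> y) -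
    (\<phi> x + \<rho>\<^sup>2 * (H (sgn (grad \<phi> x)) \<bullet> sgn (grad \<phi> x)) / 2)\<bar> \<le> e * \<rho>\<^sup>2"
proof -
  interpret H: bounded_linear H using has_hessian_linear[OF hess] .
  have "\<forall>\<^sub>F \<rho> in at_right 0. \<bar>(SUP y\<in>ball x \<rho>. - \<phi> y) -
    (- \<phi> x + \<rho> * norm (grad \<phi> x) - \<rho>\<^sup>2 * (H (sgn (grad \<phi> x)) \<bullet> sgn (grad \<phi> x)) / 2)\<bar> \<le> e * \<rho>\<^sup>2"
    using SUP_ball_second_order[OF has_hessian_uminus(2)[OF hess] _ e] g
    by (simp add: has_hessian_uminus(1)[OF hess] sgn_minus H.neg)
  with SUP_ball_second_order[OF hess g e] show ?thesis
    unfolding INF_eq_minus_SUP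
    by eventually_elim linarith
qed

lemma set_integral_ball_translate:
  fixes f :: "'a::euclidean_space \<Rightarrow> real"
  assumes "set_integrable lborel (ball x \<rho>) f"
  shows "(LINT y:ball x \<rho>|lborel. f y) = (LINT h:ball 0 \<rho>|lborel. f (x + h))"
proof -
  have meas: "(\<lambda>y. indicator (ball x \<rho>) y *\<^sub>R f y) \<in> borel_measurable borel"
    using assms unfolding set_integrable_def by (auto dest: borel_measurable_integrable)
  have "(LINT y:ball x \<rho>|lborel. f y) = (\<integral>y. indicator (ball x \<rho>) y *\<^sub>R f y \<partial>distr lborel borel ((+) x))"
    unfolding set_lebesgue_integral_def lborel_distr_plus ..
  also have "\<dots> = (\<integral>h. indicator (ball x \<rho>) (x + h) *\<^sub>R f (x + h) \<partial>lborel)"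
    using meas by (intro integral_distr) auto
  also have "\<dots> = (LINT h:ball 0 \<rho>|lborel. f (x + h))"
    unfolding set_lebesgue_integral_def
    by (intro Bochner_Integration.integral_cong) (auto simp: indicator_def dist_norm)
  finally show ?thesis .
qed

lemma set_integral_ball_quadratic_polynomial:
  fixes H :: "'a::euclidean_space \<Rightarrow> 'a"
  assumes H: "bounded_linear H" and \<rho>: "\<rho> > 0"
  shows "set_integrable lborel (ball 0 \<rho>) (\<lambda>h. c + g \<bullet> h + H h \<bullet> h / 2)"
    and "(LINT h:ball 0 \<rho>|lborel. c + g \<bullet> h + H h \<bullet> h / 2)
      = measure lborel (ball (0::'a) \<rho>) * (c + \<rho>\<^sup>2 * (\<Sum>b\<in>Basis. H b \<bullet> b) / (2 * real (DIM('a) + 2)))"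
proof -
  have contH: "continuous_on (cball 0 \<rho>) H" using H by (rule linear_continuous_on)
  have int: "set_integrable lborel (ball 0 \<rho>) (\<lambda>h::'a. c)"
    "set_integrable lborel (ball 0 \<rho>) (\<lambda>h::'a. g \<bullet> h)"
    "set_integrable lborel (ball 0 \<rho>) (\<lambda>h::'a. H h \<bullet> h)"
    by (intro set_integrable_ball continuous_intros contH)+
  have int': "set_integrable lborel (ball 0 \<rho>) (\<lambda>h::'a. 1 / 2 * (H h \<bullet> h))"
    using int(3) by (intro set_integrable_mult_right)
  show "set_integrable lborel (ball 0 \<rho>) (\<lambda>h. c + g \<bullet> h + H h \<bullet> h / 2)"
    using int(1,2) int' by (auto intro!: set_integral_add(1))
  have "(LINT h:ball 0 \<rho>|lborel. c + g \<bullet> h + 1 / 2 * (H h \<bullet> h)) = 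
    (LINT h:ball (0::'a) \<rho>|lborel. c) + (LINT h:ball (0::'a) \<rho>|lborel. g \<bullet> h)
     + (LINT h:ball (0::'a) \<rho>|lborel. 1 / 2 * (H h \<bullet> h))"
    by (simp only: set_integral_add int int')
  moreover have "(LINT h:ball (0::'a) \<rho>|lborel. c) = measure lborel (ball (0::'a) \<rho>) * c"
    using emeasure_lborel_ball_finite[of "0::'a" \<rho>] by (simp add: set_lebesgue_integral_def)
  ultimately show "(LINT h:ball 0 \<rho>|lborel. c + g \<bullet> h + H h \<bullet> h / 2)
      = measure lborel (ball (0::'a) \<rho>) * (c + \<rho>\<^sup>2 * (\<Sum>b\<in>Basis. H b \<bullet> b) / (2 * real (DIM('a) + 2)))"
    using \<rho> H by (simp add: set_integral_ball_inner set_integral_ball_quadratic_form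
        bounded_linear.linear field_simps)
qed

lemma ball_mean_second_order:
  fixes x :: "'a::euclidean_space"
  assumes hess: "has_hessian \<phi> x H" and e: "e > 0"
  shows "\<forall>\<^sub>F \<rho> in at_right 0. \<bar>1 / measure lborel (ball x \<rho>) * (LINT y:ball x \<rho>|lborel. \<phi> y) -
    (\<phi> x + \<rho>\<^sup>2 * (\<Sum>b\<in>Basis. H b \<bullet> b) / (2 * real (DIM('a) + 2)))\<bar> \<le> e * \<rho>\<^sup>2"
  using eventually_at_right_cball[OF has_hessian_taylor[OF hess e]] has_hessian_continuous[OF hess]
    eventually_at_right_less
proof eventually_elim
  case (elim \<rho>)
  define V where "V = measure lborel (ball (0::'a) \<rho>)"
  define T where "T = \<rho>\<^sup>2 * (\<Sum>b\<in>Basis. H b \<bullet> b) / (2 * real (DIM('a) + 2))"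
  have V: "measure lborel (ball x \<rho>) = V" "V > 0"
    using elim(3) by (auto simp: V_def content_ball)
  have H: "bounded_linear H" using has_hessian_linear[OF hess] .
  note poly = set_integral_ball_quadratic_polynomial[OF H elim(3)]
  have int: "set_integrable lborel (ball 0 \<rho>) (\<lambda>h. \<phi> (x + h))"
  proof (intro set_integrable_ball continuous_on_compose2[OF elim(2)] continuous_intros)
    show "(\<lambda>h. x + h) ` cball 0 \<rho> \<subseteq> cball x \<rho>" by (auto simp: dist_norm)
  qed
  have tay: "\<bar>\<phi> (x + h) - \<phi> x - grad \<phi> x \<bullet> h - H h \<bullet> h / 2\<bar> \<le> e * \<rho>\<^sup>2" if h: "h \<in> ball 0 \<rho>" for h
  proof -
    have "x + h \<in> cball x \<rho>" using h by (simp add: dist_norm)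
    then have "\<bar>\<phi> (x + h) - \<phi> x - grad \<phi> x \<bullet> h - H h \<bullet> h / 2\<bar> \<le> e * (norm h)\<^sup>2"
      using elim(1) by fastforce
    also have "\<dots> \<le> e * \<rho>\<^sup>2" using h e by (intro mult_left_mono power_mono) auto
    finally show ?thesis .
  qed
  have "(LINT h:ball 0 \<rho>|lborel. \<phi> (x + h))
      \<le> (LINT h:ball 0 \<rho>|lborel. (\<phi> x + e * \<rho>\<^sup>2) + grad \<phi> x \<bullet> h + H h \<bullet> h / 2)"
    using tay by (intro set_integral_mono int poly(1)) (auto simp: abs_le_iff algebra_simps)
  moreover have "(LINT h:ball 0 \<rho>|lborel. (\<phi> x - e * \<rho>\<^sup>2) + grad \<phi> x \<bullet> h + H h \<bullet> h / 2)
      \<le> (LINT h:ball 0 \<rho>|lborel. \<phi> (x + h))"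
    using tay by (intro set_integral_mono int poly(1)) (auto simp: abs_le_iff algebra_simps)
  ultimately have "(LINT y:ball x \<rho>|lborel. \<phi> y) \<le> V * (\<phi> x + e * \<rho>\<^sup>2 + T)"
    "V * (\<phi> x - e * \<rho>\<^sup>2 + T) \<le> (LINT y:ball x \<rho>|lborel. \<phi> y)"
    unfolding poly(2) V_def[symmetric] T_def[symmetric]
      set_integral_ball_translate[OF set_integrable_ball[OF elim(2)]] by auto
  then have "1 / V * (LINT y:ball x \<rho>|lborel. \<phi> y) \<le> \<phi> x + e * \<rho>\<^sup>2 + T"
    "\<phi> x - e * \<rho>\<^sup>2 + T \<le> 1 / V * (LINT y:ball x \<rho>|lborel. \<phi> y)"
    using V(2) by (simp_all add: field_simps)
  then show ?case unfolding V(1) T_def[symmetric] by (simp add: abs_le_iff)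
qed

section \<open>Expansion of the mean operator\<close>

lemma c_beta_bounds:
  assumes "p > 2"
  shows "0 \<le> c_beta p d" "c_beta p d \<le> 1"
  using assms by (auto simp: c_beta_def field_simps)

lemma c_gamma_pos: "p > 2 \<Longrightarrow> c_gamma p d > 0"
  by (simp add: c_gamma_def)

lemma c_gamma_sq: "p > 2 \<Longrightarrow> (c_gamma p d)\<^sup>2 = 2 * (p + real d)"
  by (simp add: c_gamma_def)

lemma filterlim_scale_at_right_0:
  assumes "(c::real) > 0"
  shows "filterlim (\<lambda>r. c * r) (at_right 0) (at_right 0)"
proof -
  have "((\<lambda>r. c * r) \<longlongrightarrow> c * 0) (at_right 0)"
    by (intro tendsto_intros)
  moreover have "\<forall>\<^sub>F r in at_right 0. c * r \<in> {0<..} \<and> c * r \<noteq> 0"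
    using eventually_at_right_less[of "0::real"] by eventually_elim (use assms in auto)
  ultimately show ?thesis by (simp add: filterlim_at)
qed

text \<open>
  With \<open>H\<close> the Hessian and \<open>g\<close> the gradient of \<open>\<phi>\<close>, this is the factor that multiplies
  \<open>norm g powr (p - 2)\<close> in the \<open>p\<close>-Laplacian.
\<close>

definition normalized_p_laplacian :: "real \<Rightarrow> ('a::euclidean_space \<Rightarrow> 'a) \<Rightarrow> 'a \<Rightarrow> real" where
  "normalized_p_laplacian p H g = (p - 2) * (H (sgn g) \<bullet> sgn g) + (\<Sum>b\<in>Basis. H b \<bullet> b)"

text \<open>
  The weights and the radius are chosen so that
  \<open>c_beta p d * (c_gamma p d)\<^sup>2 / 2 = p - 2\<close> and
  \<open>(1 - c_beta p d) * (c_gamma p d)\<^sup>2 / (2 * (d + 2)) = 1\<close>.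
\<close>

lemma mean_op_second_order:
  fixes x :: "'a::euclidean_space"
  assumes hess: "has_hessian \<phi> x H" and g: "grad \<phi> x \<noteq> 0" and e: "e > 0" and p: "p > 2"
  shows "\<forall>\<^sub>F r in at_right 0.
    \<bar>mean_op p r \<phi> x - (\<phi> x + r\<^sup>2 * normalized_p_laplacian p H (grad \<phi> x))\<bar> \<le> e * r\<^sup>2"
proof -
  define \<beta> where "\<beta> = c_beta p DIM('a)"
  define \<gamma> where "\<gamma> = c_gamma p DIM('a)"
  define q where "q = H (sgn (grad \<phi> x)) \<bullet> sgn (grad \<phi> x)"
  define K where "K = 2 * real (DIM('a) + 2)"
  have K: "K \<noteq> 0" by (simp add: K_def)
  define T where "T = (\<Sum>b\<in>Basis. H b \<bullet> b)"
  have \<gamma>: "\<gamma> > 0" "\<gamma>\<^sup>2 = 2 * (p + real DIM('a))"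
    using p by (auto simp: \<gamma>_def c_gamma_pos c_gamma_sq)
  have \<beta>: "0 \<le> \<beta>" "\<beta> \<le> 1" using c_beta_bounds[OF p] by (auto simp: \<beta>_def)
  have b1: "\<beta> * \<gamma>\<^sup>2 = 2 * (p - 2)"
  proof -
    have "p + real DIM('a) \<noteq> 0" using p of_nat_0_le_iff[of "DIM('a)"] by linarith
    moreover have "(p - 2) / s * (2 * s) = 2 * (p - 2)" if "s \<noteq> 0" for s using that by simp
    ultimately show ?thesis unfolding \<beta>_def c_beta_def \<gamma>(2) by blast
  qed
  have b2: "(1 - \<beta>) * \<gamma>\<^sup>2 = K"
  proof -
    have "(1 - \<beta>) * \<gamma>\<^sup>2 = \<gamma>\<^sup>2 - \<beta> * \<gamma>\<^sup>2" by (simp add: algebra_simps)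
    then show ?thesis unfolding b1 unfolding \<gamma>(2) K_def by simp
  qed
  \<comment> \<open>The estimates are in terms of the radius \<open>\<gamma> * r\<close>, the conclusion in terms of \<open>r\<close>.\<close>
  define e' where "e' = e / \<gamma>\<^sup>2"
  have e': "e' > 0" "e' * \<gamma>\<^sup>2 = e" using e \<gamma>(1) by (auto simp: e'_def)
  have lim: "filterlim (\<lambda>r. \<gamma> * r) (at_right 0) (at_right 0)"
    by (rule filterlim_scale_at_right_0[OF \<gamma>(1)])
  show ?thesis
    using eventually_compose_filterlim[OF midrange_ball_second_order[OF hess g e'(1)] lim]
      eventually_compose_filterlim[OF ball_mean_second_order[OF hess e'(1)] lim]
  proof eventually_elim
    case (elim r)
    define mid where "mid = 1/2 * (SUP y\<in>ball x (\<gamma> * r). \<phi> y) + 1/2 * (INF y\<in>ball x (\<gamma> * r). \<phi> y)"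
    define avg where "avg = 1 / measure lborel (ball x (\<gamma> * r)) * (LINT y:ball x (\<gamma> * r)|lborel. \<phi> y)"
    define E where "E = e' * (\<gamma> * r)\<^sup>2"
    have E: "E = e * r\<^sup>2" unfolding E_def e'(2)[symmetric] by (simp add: power_mult_distrib)
    have m: "\<bar>mid - (\<phi> x + (\<gamma> * r)\<^sup>2 * q / 2)\<bar> \<le> E"
      using elim(1) by (simp only: mid_def q_def E_def)
    have a: "\<bar>avg - (\<phi> x + (\<gamma> * r)\<^sup>2 * T / K)\<bar> \<le> E"
      using elim(2) by (simp only: avg_def T_def E_def K_def)
    have "mean_op p r \<phi> x = \<beta> * mid + (1 - \<beta>) * avg"
      by (simp add: mean_op_def Let_def mid_def avg_def \<beta>_def \<gamma>_def)
    moreover have "r\<^sup>2 * ((p - 2) * q + T)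
       = \<beta> * ((\<gamma> * r)\<^sup>2 * q / 2) + (1 - \<beta>) * ((\<gamma> * r)\<^sup>2 * T / K)"
    proof -
      have "\<beta> * ((\<gamma> * r)\<^sup>2 * q / 2) = (\<beta> * \<gamma>\<^sup>2) * (r\<^sup>2 * q / 2)"
        by (simp add: power_mult_distrib)
      also have "\<dots> = r\<^sup>2 * ((p - 2) * q)" unfolding b1 by simp
      finally have 1: "\<beta> * ((\<gamma> * r)\<^sup>2 * q / 2) = r\<^sup>2 * ((p - 2) * q)" .
      have "(1 - \<beta>) * ((\<gamma> * r)\<^sup>2 * T / K) = ((1 - \<beta>) * \<gamma>\<^sup>2) * (r\<^sup>2 * T / K)"
        by (simp add: power_mult_distrib)
      also have "\<dots> = r\<^sup>2 * T" unfolding b2 using K by simp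
      finally show ?thesis unfolding 1 by (simp add: distrib_left)
    qed
    ultimately have "mean_op p r \<phi> x - (\<phi> x + r\<^sup>2 * ((p - 2) * q + T))
       = \<beta> * (mid - (\<phi> x + (\<gamma> * r)\<^sup>2 * q / 2))
       + (1 - \<beta>) * (avg - (\<phi> x + (\<gamma> * r)\<^sup>2 * T / K))"
      by (simp add: algebra_simps)
    also have "\<bar>\<dots>\<bar> \<le> \<beta> * \<bar>mid - (\<phi> x + (\<gamma> * r)\<^sup>2 * q / 2)\<bar>
       + (1 - \<beta>) * \<bar>avg - (\<phi> x + (\<gamma> * r)\<^sup>2 * T / K)\<bar>"
      using \<beta> by (intro order_trans[OF abs_triangle_ineq]) (simp add: abs_mult)
    also have "\<dots> \<le> \<beta> * E + (1 - \<beta>) * E"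
      using \<beta> m a by (intro add_mono mult_left_mono) auto
    finally show ?case
      by (simp add: E normalized_p_laplacian_def q_def T_def algebra_simps)
  qed
qed

text \<open>
  At a critical point the direction of the gradient is lost, but a bound of order \<open>r\<^sup>2\<close> is enough:
  the control \<open>c\<close> can be taken large there, which makes the coefficient of that bound small.
\<close>

lemma mean_op_le_at_critical_point:
  fixes x :: "'a::euclidean_space"
  assumes hess: "has_hessian \<phi> x H" and g: "grad \<phi> x = 0" and p: "p > 2"
  shows "\<exists>C. \<forall>\<^sub>F r in at_right 0. mean_op p r \<phi> x \<le> \<phi> x + r\<^sup>2 * C"
proof -
  define \<beta> where "\<beta> = c_beta p DIM('a)"
  define \<gamma> where "\<gamma> = c_gamma p DIM('a)"
  define T where "T = \<bar>(\<Sum>b\<in>Basis. H b \<bullet> b) / (2 * real (DIM('a) + 2))\<bar>"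
  have \<gamma>: "\<gamma> > 0" using p by (auto simp: \<gamma>_def c_gamma_pos)
  have \<beta>: "0 \<le> \<beta>" "\<beta> \<le> 1" using c_beta_bounds[OF p] by (auto simp: \<beta>_def)
  obtain N where N: "N > 0" "\<And>h. norm (H h) \<le> N * norm h"
    using linear_bound[OF has_hessian_linear[OF hess]] by blast
  define C where "C = N + 1 + T"
  have T: "T \<ge> 0" by (simp add: T_def)
  have lim: "filterlim (\<lambda>r. \<gamma> * r) (at_right 0) (at_right 0)"
    by (rule filterlim_scale_at_right_0[OF \<gamma>(1)])
  have mid: "\<forall>\<^sub>F \<rho> in at_right 0. 1/2 * (SUP y\<in>ball x \<rho>. \<phi> y) + 1/2 * (INF y\<in>ball x \<rho>. \<phi> y) \<le> \<phi> x + \<rho>\<^sup>2 * C"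
    using eventually_at_right_cball[OF has_hessian_taylor[OF hess zero_less_one]]
      has_hessian_continuous[OF hess] has_hessian_continuous[OF has_hessian_uminus(2)[OF hess]]
      eventually_at_right_less
  proof eventually_elim
    case (elim \<rho>)
    have "(SUP y\<in>ball x \<rho>. \<phi> y) \<le> \<phi> x + \<rho>\<^sup>2 * (N + 1)"
    proof (rule SUP_ball_le)
      fix y assume y: "y \<in> ball x \<rho>"
      have n: "norm (y - x) \<le> \<rho>" using y by (simp add: dist_norm norm_minus_commute)
      have "\<phi> y \<le> \<phi> x + H (y - x) \<bullet> (y - x) / 2 + 1 * (norm (y - x))\<^sup>2"
        using elim(1) y g by (auto simp: abs_le_iff algebra_simps)
      also have "H (y - x) \<bullet> (y - x) \<le> norm (H (y - x)) * norm (y - x)" by (rule norm_cauchy_schwarz)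
      also have "\<dots> \<le> N * norm (y - x) * norm (y - x)" using N(2) by (intro mult_right_mono) auto
      also have "\<phi> x + N * norm (y - x) * norm (y - x) / 2 + 1 * (norm (y - x))\<^sup>2 
        = \<phi> x + (norm (y - x))\<^sup>2 * (N / 2 + 1)"
        by (simp add: algebra_simps power2_eq_square)
      also have "\<dots> \<le> \<phi> x + \<rho>\<^sup>2 * (N + 1)"
        using n N(1) by (intro add_left_mono mult_mono power_mono) auto
      finally show "\<phi> y \<le> \<phi> x + \<rho>\<^sup>2 * (N + 1)" by simp
    qed (use elim in auto)
    moreover have "(INF y\<in>ball x \<rho>. \<phi> y) \<le> \<phi> x"
      using le_SUP_ball[OF elim(3,4), of x] elim(4) by (simp add: INF_eq_minus_SUP)
    moreover have "0 \<le> \<rho>\<^sup>2 * (N + 1)" "0 \<le> \<rho>\<^sup>2 * T" using N(1) T by auto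
    ultimately show ?case by (simp add: C_def algebra_simps)
  qed
  have "\<forall>\<^sub>F r in at_right 0. mean_op p r \<phi> x \<le> \<phi> x + r\<^sup>2 * (\<gamma>\<^sup>2 * C)"
    using eventually_compose_filterlim[OF mid lim]
      eventually_compose_filterlim[OF ball_mean_second_order[OF hess zero_less_one] lim]
  proof eventually_elim
    case (elim r)
    define mid where "mid = 1/2 * (SUP y\<in>ball x (\<gamma> * r). \<phi> y) + 1/2 * (INF y\<in>ball x (\<gamma> * r). \<phi> y)"
    define avg where "avg = 1 / measure lborel (ball x (\<gamma> * r)) * (LINT y:ball x (\<gamma> * r)|lborel. \<phi> y)"
    define K where "K = \<phi> x + (\<gamma> * r)\<^sup>2 * C"
    have "mid \<le> K" using elim(1) by (simp add: mid_def K_def)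
    moreover have "avg \<le> K"
    proof -
      have "avg \<le> \<phi> x + (\<gamma> * r)\<^sup>2 * ((\<Sum>b\<in>Basis. H b \<bullet> b) / (2 * real (DIM('a) + 2)) + 1)"
        using elim(2) unfolding avg_def[symmetric] abs_le_iff by (simp add: algebra_simps)
      also have "\<dots> \<le> K"
        unfolding K_def C_def T_def using N(1) abs_ge_self[of "(\<Sum>b\<in>Basis. H b \<bullet> b) / (2 * real (DIM('a) + 2))"]
        by (intro add_left_mono mult_left_mono) (linarith, simp)
      finally show ?thesis .
    qed
    ultimately have "\<beta> * mid + (1 - \<beta>) * avg \<le> \<beta> * K + (1 - \<beta>) * K"
      using \<beta> by (intro add_mono mult_left_mono) auto
    moreover have "mean_op p r \<phi> x = \<beta> * mid + (1 - \<beta>) * avg"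
      by (simp add: mean_op_def Let_def mid_def avg_def \<beta>_def \<gamma>_def)
    ultimately show ?case by (simp add: K_def power_mult_distrib algebra_simps)
  qed
  then show ?thesis ..
qed

section \<open>The one-parameter family of controls\<close>

lemma c_alpha_bounds:
  assumes "p > 2"
  shows "0 < c_alpha p" "c_alpha p < 1"
  using assms by (auto simp: c_alpha_def)

lemma powr_tendsto_0_at_right:
  assumes "(a::real) > 0"
  shows "((\<lambda>\<epsilon>. \<epsilon> powr a) \<longlongrightarrow> 0) (at_right 0)"
  using assms eventually_mono[OF eventually_at_right_less[of "0::real"] less_imp_le]
  by (intro tendsto_zero_powrI[OF tendsto_ident_at tendsto_const]) auto

text \<open>
  The exponents of \<open>m\<close> and \<open>M\<close> ensure that both radii tend to \<open>0\<close> uniformly over the admissible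
  controls, while every fixed \<open>c > 0\<close> is eventually admissible.
\<close>

locale control_range =
  fixes p :: real and m M :: "real \<Rightarrow> real"
  assumes p: "p > 2"
    and m: "\<And>\<epsilon>. \<epsilon> > 0 \<Longrightarrow> m \<epsilon> = \<epsilon> powr (2 / (2 + c_alpha p))"
    and M: "\<And>\<epsilon>. \<epsilon> > 0 \<Longrightarrow> M \<epsilon> = \<epsilon> powr (- (2 / (2 - c_alpha p)))"
begin

abbreviation \<alpha> :: real where "\<alpha> \<equiv> c_alpha p"

lemma \<alpha>: "0 < \<alpha>" "\<alpha> < 1"
  using c_alpha_bounds[OF p] by auto

lemma radii_bounds:
  assumes \<epsilon>: "\<epsilon> > 0" and c: "c \<in> {m \<epsilon>..M \<epsilon>}"
  shows "c > 0" "\<epsilon>\<^sup>2 * c powr (1 - \<alpha>) \<le> \<epsilon> powr (2 / (2 - \<alpha>))"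
    "\<epsilon> * c powr (- \<alpha> / 2) \<le> \<epsilon> powr (2 / (2 + \<alpha>))"
proof -
  have mM: "0 < m \<epsilon>" "m \<epsilon> \<le> c" "c \<le> M \<epsilon>" using c \<epsilon> by (auto simp: m)
  show c0: "c > 0" using mM by linarith
  have "\<epsilon>\<^sup>2 * c powr (1 - \<alpha>) \<le> \<epsilon>\<^sup>2 * M \<epsilon> powr (1 - \<alpha>)"
    using mM c0 \<alpha> by (intro mult_left_mono powr_mono2) auto
  also have "\<dots> = \<epsilon> powr 2 * \<epsilon> powr (- (2 / (2 - \<alpha>)) * (1 - \<alpha>))"
    using \<epsilon> by (simp add: M powr_powr)
  also have "\<dots> = \<epsilon> powr (2 + - (2 / (2 - \<alpha>)) * (1 - \<alpha>))" by (rule powr_add[symmetric])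
  also have "2 + - (2 / (2 - \<alpha>)) * (1 - \<alpha>) = 2 / (2 - \<alpha>)"
    using \<alpha> by (simp add: field_simps)
  finally show "\<epsilon>\<^sup>2 * c powr (1 - \<alpha>) \<le> \<epsilon> powr (2 / (2 - \<alpha>))" .
  have "\<epsilon> * c powr (- \<alpha> / 2) \<le> \<epsilon> * m \<epsilon> powr (- \<alpha> / 2)"
    using mM \<epsilon> \<alpha> by (intro mult_left_mono powr_mono2') auto
  also have "\<dots> = \<epsilon> powr 1 * \<epsilon> powr (2 / (2 + \<alpha>) * (- \<alpha> / 2))"
    using \<epsilon> by (simp add: m powr_powr)
  also have "\<dots> = \<epsilon> powr (1 + 2 / (2 + \<alpha>) * (- \<alpha> / 2))" by (rule powr_add[symmetric])
  also have "1 + 2 / (2 + \<alpha>) * (- \<alpha> / 2) = 2 / (2 + \<alpha>)"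
    using \<alpha> by (simp add: field_simps)
  finally show "\<epsilon> * c powr (- \<alpha> / 2) \<le> \<epsilon> powr (2 / (2 + \<alpha>))" .
qed

text \<open>
  All asymptotic statements about small radii are transferred through this lemma to statements
  uniform in the control.
\<close>

lemma eventually_all_controls:
  assumes P: "\<forall>\<^sub>F \<rho> in at_right 0. P \<rho>" and Q: "\<forall>\<^sub>F r in at_right 0. Q r"
  shows "\<forall>\<^sub>F \<epsilon> in at_right 0. \<forall>c\<in>{m \<epsilon>..M \<epsilon>}.
     P (\<epsilon>\<^sup>2 * c powr (1 - \<alpha>)) \<and> Q (\<epsilon> * c powr (- \<alpha> / 2))"
proof -
  obtain d where d: "d > 0" "\<And>\<rho>. 0 < \<rho> \<Longrightarrow> \<rho> < d \<Longrightarrow> P \<rho> \<and> Q \<rho>"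
    using eventually_conj[OF P Q] unfolding eventually_at_right_field by blast
  have "\<forall>\<^sub>F \<epsilon> in at_right 0. \<epsilon> powr (2 / (2 - \<alpha>)) < d" "\<forall>\<^sub>F \<epsilon> in at_right 0. \<epsilon> powr (2 / (2 + \<alpha>)) < d"
    using \<alpha> d(1) by (auto intro!: order_tendstoD(2)[OF powr_tendsto_0_at_right])
  then show ?thesis using eventually_at_right_less
  proof eventually_elim
    case (elim \<epsilon>)
    show ?case
    proof
      fix c assume c: "c \<in> {m \<epsilon>..M \<epsilon>}"
      note b = radii_bounds[OF elim(3) c]
      have "0 < \<epsilon>\<^sup>2 * c powr (1 - \<alpha>)" "0 < \<epsilon> * c powr (- \<alpha> / 2)" using b(1) elim(3) by auto
      then show "P (\<epsilon>\<^sup>2 * c powr (1 - \<alpha>)) \<and> Q (\<epsilon> * c powr (- \<alpha> / 2))"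
        using d(2) b elim by force
    qed
  qed
qed

lemma eventually_control_admissible:
  assumes c: "c > 0"
  shows "\<forall>\<^sub>F \<epsilon> in at_right 0. c \<in> {m \<epsilon>..M \<epsilon>}"
proof -
  have "\<forall>\<^sub>F \<epsilon> in at_right 0. \<epsilon> powr (2 / (2 + \<alpha>)) < c" "\<forall>\<^sub>F \<epsilon> in at_right 0. \<epsilon> powr (2 / (2 - \<alpha>)) < 1 / c"
    using \<alpha> c by (auto intro!: order_tendstoD(2)[OF powr_tendsto_0_at_right])
  then show ?thesis using eventually_at_right_less
  proof eventually_elim
    case (elim \<epsilon>)
    have "c < 1 / \<epsilon> powr (2 / (2 - \<alpha>))" using elim c by (simp add: field_simps)
    also have "\<dots> = M \<epsilon>" using elim(3) by (simp add: M powr_minus_divide)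
    finally show ?case using elim by (simp add: m)
  qed
qed

definition plus_term :: "real \<Rightarrow> ('a::euclidean_space \<Rightarrow> real) \<Rightarrow> 'a \<Rightarrow> real \<Rightarrow> real" where
  "plus_term \<epsilon> \<phi> x c = \<alpha> * (SUP y\<in>ball x (\<epsilon>^2 * c powr (1 - \<alpha>)). \<phi> y)
        + (1 - \<alpha>) * mean_op p (\<epsilon> * c powr (- \<alpha> / 2)) \<phi> x"

lemma avg_plus_eq: "avg_plus p m M \<epsilon> \<phi> x = (INF c\<in>{m \<epsilon>..M \<epsilon>}. plus_term \<epsilon> \<phi> x c)"
  by (simp add: avg_plus_def plus_term_def Let_def)

text \<open>
  The coefficient of \<open>\<epsilon>\<^sup>2\<close> in the quantity minimised over \<open>c\<close>, where \<open>a\<close> stands for the norm of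
  the gradient and \<open>D\<close> for the normalised \<open>p\<close>-Laplacian.
\<close>

definition cost :: "real \<Rightarrow> real \<Rightarrow> real \<Rightarrow> real" where
  "cost a D c = \<alpha> * (c powr (1 - \<alpha>) * a) + (1 - \<alpha>) * (c powr (- \<alpha>) * D)"

lemma cost_expand:
  "\<alpha> * (u + \<epsilon>\<^sup>2 * c powr (1 - \<alpha>) * a) + (1 - \<alpha>) * (u + (\<epsilon> * c powr (- \<alpha> / 2))\<^sup>2 * D)
     = u + \<epsilon>\<^sup>2 * cost a D c"
proof -
  have "(c powr (- \<alpha> / 2))\<^sup>2 = c powr (- \<alpha>)"
    by (simp add: power2_eq_square flip: powr_add)
  then show ?thesis by (simp add: cost_def power_mult_distrib algebra_simps)
qed

lemma plus_term_le:
  assumes hess: "has_hessian \<phi> x H" and e: "e > 0"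
    and mean: "\<forall>\<^sub>F r in at_right 0. mean_op p r \<phi> x \<le> \<phi> x + r\<^sup>2 * D"
  shows "\<forall>\<^sub>F \<epsilon> in at_right 0. \<forall>c\<in>{m \<epsilon>..M \<epsilon>}.
    plus_term \<epsilon> \<phi> x c \<le> \<phi> x + \<epsilon>\<^sup>2 * cost (norm (grad \<phi> x) + e) D c"
  using eventually_all_controls[OF SUP_ball_first_order_le[OF hess e] mean]
proof eventually_elim
  case (elim \<epsilon>)
  then show ?case
    unfolding plus_term_def cost_expand[symmetric] using \<alpha>
    by (auto intro!: add_mono mult_left_mono)
qed

lemma plus_term_ge:
  assumes hess: "has_hessian \<phi> x H" and e: "e > 0"
    and mean: "\<forall>\<^sub>F r in at_right 0. mean_op p r \<phi> x \<ge> \<phi> x + r\<^sup>2 * D"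
  shows "\<forall>\<^sub>F \<epsilon> in at_right 0. \<forall>c\<in>{m \<epsilon>..M \<epsilon>}.
    plus_term \<epsilon> \<phi> x c \<ge> \<phi> x + \<epsilon>\<^sup>2 * cost (norm (grad \<phi> x) - e) D c"
  using eventually_all_controls[OF SUP_ball_first_order_ge[OF hess e] mean]
proof eventually_elim
  case (elim \<epsilon>)
  then show ?case
    unfolding plus_term_def cost_expand[symmetric] using \<alpha>
    by (auto intro!: add_mono mult_left_mono)
qed

end

lemma mean_op_uminus: "mean_op p r (\<lambda>y. - \<phi> y) x = - mean_op p r \<phi> x"
proof -
  have "(LINT y:B|lborel. - \<phi> y) = - (LINT y:B|lborel. \<phi> y)" for B
    by (simp add: set_lebesgue_integral_def)
  then show ?thesis
    unfolding mean_op_def Let_def INF_eq_minus_SUP by (simp add: algebra_simps)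
qed

text \<open>
  A common form of the upper bounds at regular and at critical points. At a critical point \<open>D\<close> is
  only some constant.
\<close>

lemma mean_op_upper:
  fixes x :: "'a::euclidean_space"
  assumes hess: "has_hessian \<phi> x H" and p: "p > 2"
  obtains D where "grad \<phi> x \<noteq> 0 \<Longrightarrow> D = normalized_p_laplacian p H (grad \<phi> x)"
    and "\<And>e. e > 0 \<Longrightarrow> \<forall>\<^sub>F r in at_right 0. mean_op p r \<phi> x \<le> \<phi> x + r\<^sup>2 * (D + e)"
proof (cases "grad \<phi> x = 0")
  case True
  obtain C where C: "\<forall>\<^sub>F r in at_right 0. mean_op p r \<phi> x \<le> \<phi> x + r\<^sup>2 * C"
    using mean_op_le_at_critical_point[OF hess True p] by blast
  have "\<forall>\<^sub>F r in at_right 0. mean_op p r \<phi> x \<le> \<phi> x + r\<^sup>2 * (C + e)" if "e > 0" for e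
    using C
  proof eventually_elim
    case (elim r)
    have "r\<^sup>2 * C \<le> r\<^sup>2 * (C + e)" using that by (intro mult_left_mono) auto
    then show ?case using elim by linarith
  qed
  with True that show ?thesis by blast
next
  case False
  have "\<forall>\<^sub>F r in at_right 0. mean_op p r \<phi> x
      \<le> \<phi> x + r\<^sup>2 * (normalized_p_laplacian p H (grad \<phi> x) + e)" if "e > 0" for e
    using mean_op_second_order[OF hess False that p]
    by eventually_elim (simp only: abs_le_iff distrib_left, simp add: algebra_simps)
  with that show ?thesis by blast
qed

context control_range
begin

text \<open>
  A real infimum is a lower bound only for sets that are bounded below. Boundedness comes from
  \<open>\<phi> x \<le> sup \<phi>\<close> and from the lower bound of the mean operator, which is the upper bound for \<open>- \<phi>\<close>.
\<close>

lemma avg_plus_le_plus_term: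
  assumes hess: "has_hessian \<phi> x H"
  shows "\<forall>\<^sub>F \<epsilon> in at_right 0. \<forall>c\<in>{m \<epsilon>..M \<epsilon>}. avg_plus p m M \<epsilon> \<phi> x \<le> plus_term \<epsilon> \<phi> x c"
proof -
  have SUP: "\<forall>\<^sub>F \<rho> in at_right 0. \<phi> x \<le> (SUP y\<in>ball x \<rho>. \<phi> y)"
    using has_hessian_continuous[OF hess] eventually_at_right_less
    by eventually_elim (auto intro: le_SUP_ball)
  obtain D where "\<And>e. e > 0 \<Longrightarrow>
      \<forall>\<^sub>F r in at_right 0. mean_op p r (\<lambda>y. - \<phi> y) x \<le> - \<phi> x + r\<^sup>2 * (D + e)"
    by (rule mean_op_upper[OF has_hessian_uminus(2)[OF hess] p]) (rule that)
  from this[OF zero_less_one]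
  have D: "\<forall>\<^sub>F r in at_right 0. mean_op p r (\<lambda>y. - \<phi> y) x \<le> - \<phi> x + r\<^sup>2 * (D + 1)" .
  \<comment> \<open>Any lower bound uniform in \<open>c\<close> will do.\<close>
  have "((\<lambda>r. r\<^sup>2 * (D + 1)) \<longlongrightarrow> 0\<^sup>2 * (D + 1)) (at_right 0)"
    by (intro tendsto_intros)
  then have "\<forall>\<^sub>F r in at_right 0. r\<^sup>2 * (D + 1) < 1"
    by (rule order_tendstoD(2)) simp
  with D have mean: "\<forall>\<^sub>F r in at_right 0. \<phi> x - 1 \<le> mean_op p r \<phi> x"
    unfolding mean_op_uminus by eventually_elim linarith
  show ?thesis using eventually_all_controls[OF SUP mean]
  proof eventually_elim
    case (elim \<epsilon>)
    have "\<alpha> * \<phi> x + (1 - \<alpha>) * (\<phi> x - 1) \<le> plus_term \<epsilon> \<phi> x c" if "c \<in> {m \<epsilon>..M \<epsilon>}" for c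
      unfolding plus_term_def using elim that \<alpha> by (intro add_mono mult_left_mono) auto
    then have "bdd_below (plus_term \<epsilon> \<phi> x ` {m \<epsilon>..M \<epsilon>})" by (rule bdd_belowI2)
    then show ?case unfolding avg_plus_eq by (auto intro: cINF_lower)
  qed
qed

text \<open>
  For upper bounds it suffices to test with a single control, fixed while \<open>\<epsilon>\<close> tends to \<open>0\<close>.
\<close>

lemma avg_plus_le:
  assumes hess: "has_hessian \<phi> x H"
    and mean: "\<And>e. e > 0 \<Longrightarrow> \<forall>\<^sub>F r in at_right 0. mean_op p r \<phi> x \<le> \<phi> x + r\<^sup>2 * (D + e)"
    and c: "c > 0" and K: "cost (norm (grad \<phi> x)) D c < K"
  shows "\<forall>\<^sub>F \<epsilon> in at_right 0. avg_plus p m M \<epsilon> \<phi> x \<le> \<phi> x + \<epsilon>\<^sup>2 * K"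
proof -
  let ?a = "norm (grad \<phi> x)"
  have "((\<lambda>e. cost (?a + e) (D + e) c) \<longlongrightarrow> cost (?a + 0) (D + 0) c) (at_right 0)"
    unfolding cost_def by (intro tendsto_intros)
  then have "\<forall>\<^sub>F e in at_right 0. cost (?a + e) (D + e) c < K"
    using K by (intro order_tendstoD(2)) auto
  then have "\<forall>\<^sub>F e in at_right 0. e > 0 \<and> cost (?a + e) (D + e) c < K"
    using eventually_at_right_less by eventually_elim auto
  then obtain e where e: "e > 0" "cost (?a + e) (D + e) c < K"
    using eventually_happens'[OF trivial_limit_at_right_real] by blast
  show ?thesis
    using plus_term_le[OF hess e(1) mean[OF e(1)]] avg_plus_le_plus_term[OF hess]
      eventually_control_admissible[OF c]
  proof eventually_elim
    case (elim \<epsilon>)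
    have "avg_plus p m M \<epsilon> \<phi> x \<le> \<phi> x + \<epsilon>\<^sup>2 * cost (?a + e) (D + e) c"
      using elim by (meson order_trans)
    also have "\<dots> \<le> \<phi> x + \<epsilon>\<^sup>2 * K" using e(2) by (intro add_left_mono mult_left_mono) auto
    finally show ?case .
  qed
qed

text \<open>
  Weighted arithmetic-geometric mean: the powers of \<open>c\<close> cancel in the geometric mean.
\<close>

lemma cost_ge_geometric_mean:
  assumes a: "a > 0" and D: "D > 0" and c: "c > 0"
  shows "a powr \<alpha> * D powr (1 - \<alpha>) \<le> cost a D c"
proof -
  have "(c powr (1 - \<alpha>) * a) powr \<alpha> * (c powr (- \<alpha>) * D) powr (1 - \<alpha>) \<le> cost a D c"
    unfolding cost_def using assms \<alpha> by (intro Youngs_inequality_0) auto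
  also have "(c powr (1 - \<alpha>) * a) powr \<alpha> * (c powr (- \<alpha>) * D) powr (1 - \<alpha>)
      = (c powr ((1 - \<alpha>) * \<alpha>) * c powr ((- \<alpha>) * (1 - \<alpha>))) * (a powr \<alpha> * D powr (1 - \<alpha>))"
    using assms by (simp add: powr_mult powr_powr)
  also have "c powr ((1 - \<alpha>) * \<alpha>) * c powr ((- \<alpha>) * (1 - \<alpha>)) = 1"
    using c by (simp add: algebra_simps flip: powr_add)
  finally show ?thesis by simp
qed

lemma cost_at_optimum:
  assumes a: "a > 0" and D: "D > 0"
  shows "cost a D (D / a) = a powr \<alpha> * D powr (1 - \<alpha>)"
proof -
  have "(D / a) powr (1 - \<alpha>) * a = D powr (1 - \<alpha>) * (a powr 1 / a powr (1 - \<alpha>))"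
    using assms by (simp add: powr_divide)
  also have "a powr 1 / a powr (1 - \<alpha>) = a powr \<alpha>"
    by (simp only: powr_diff[symmetric]) simp
  finally have 1: "(D / a) powr (1 - \<alpha>) * a = a powr \<alpha> * D powr (1 - \<alpha>)" by simp
  have "(D / a) powr (- \<alpha>) * D = (D powr (- \<alpha>) * D powr 1) * (1 / a powr (- \<alpha>))"
    using assms by (simp add: powr_divide)
  also have "D powr (- \<alpha>) * D powr 1 = D powr (1 - \<alpha>)"
    by (simp only: powr_add[symmetric]) simp
  also have "1 / a powr (- \<alpha>) = a powr \<alpha>" by (simp add: powr_minus_divide)
  finally have 2: "(D / a) powr (- \<alpha>) * D = a powr \<alpha> * D powr (1 - \<alpha>)" by simp
  show ?thesis unfolding cost_def 1 2 by (simp add: algebra_simps)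
qed

text \<open>
  A lower bound has to hold for all admissible controls simultaneously. The errors are proportional
  to \<open>c powr (1 - \<alpha>)\<close> and \<open>c powr (- \<alpha>)\<close>, so they amount to decreasing \<open>a\<close> and \<open>D\<close> by a small \<open>e\<close>;
  the geometric mean bound then no longer contains \<open>c\<close>, and it is continuous in \<open>e\<close>.
\<close>

lemma avg_plus_ge:
  assumes hess: "has_hessian \<phi> x H" and g: "grad \<phi> x \<noteq> 0"
    and D: "D = normalized_p_laplacian p H (grad \<phi> x)" "D > 0"
    and K: "K < norm (grad \<phi> x) powr \<alpha> * D powr (1 - \<alpha>)"
  shows "\<forall>\<^sub>F \<epsilon> in at_right 0. \<phi> x + \<epsilon>\<^sup>2 * K \<le> avg_plus p m M \<epsilon> \<phi> x"
proof -
  define a where "a = norm (grad \<phi> x)"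
  have a: "a > 0" using g by (simp add: a_def)
  have "((\<lambda>e. (a - e) powr \<alpha> * (D - e) powr (1 - \<alpha>)) \<longlongrightarrow> (a - 0) powr \<alpha> * (D - 0) powr (1 - \<alpha>)) (at_right 0)"
    using a D(2) by (intro tendsto_intros) auto
  then have "\<forall>\<^sub>F e in at_right 0. K < (a - e) powr \<alpha> * (D - e) powr (1 - \<alpha>)"
    using K by (intro order_tendstoD(1)) (auto simp: a_def)
  moreover have "\<forall>\<^sub>F e in at_right 0. e < a" "\<forall>\<^sub>F e in at_right 0. e < D"
    using a D(2) by (auto intro!: order_tendstoD(2)[OF tendsto_ident_at])
  ultimately have "\<forall>\<^sub>F e in at_right 0. e > 0 \<and> e < a \<and> e < D \<and> K < (a - e) powr \<alpha> * (D - e) powr (1 - \<alpha>)"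
    using eventually_at_right_less by eventually_elim auto
  then obtain e where e: "e > 0" "e < a" "e < D" "K < (a - e) powr \<alpha> * (D - e) powr (1 - \<alpha>)"
    using eventually_happens'[OF trivial_limit_at_right_real] by blast
  have mean: "\<forall>\<^sub>F r in at_right 0. \<phi> x + r\<^sup>2 * (D - e) \<le> mean_op p r \<phi> x"
    using mean_op_second_order[OF hess g e(1) p]
    by eventually_elim (simp only: abs_le_iff D(1)[symmetric] right_diff_distrib, simp add: algebra_simps)
  show ?thesis
    using plus_term_ge[OF hess e(1) mean] eventually_control_admissible[OF zero_less_one] eventually_at_right_less
  proof eventually_elim
    case (elim \<epsilon>)
    show ?case unfolding avg_plus_eq
    proof (rule cINF_greatest)
      fix c assume c: "c \<in> {m \<epsilon>..M \<epsilon>}"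
      have "K \<le> cost (a - e) (D - e) c"
        using cost_ge_geometric_mean[of "a - e" "D - e" c] radii_bounds(1)[OF elim(3) c] e by simp
      then have "\<phi> x + \<epsilon>\<^sup>2 * K \<le> \<phi> x + \<epsilon>\<^sup>2 * cost (a - e) (D - e) c"
        by (intro add_left_mono mult_left_mono) auto
      also have "\<dots> \<le> plus_term \<epsilon> \<phi> x c" using elim(1) c by (simp add: a_def)
      finally show "\<phi> x + \<epsilon>\<^sup>2 * K \<le> plus_term \<epsilon> \<phi> x c" .
    qed (use elim(2) in blast)
  qed
qed

text \<open>
  When the first-order term is absent, the cost \<open>(1 - \<alpha>) * c powr (- \<alpha>) * D\<close> fades as \<open>c\<close> grows.
  When \<open>D \<le> 0\<close>, small \<open>c\<close> make the first-order term fade while the other term does not increase the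
  cost, and for \<open>D < 0\<close> that other term tends to minus infinity.
\<close>

lemma exists_cost_less_zero_gradient:
  assumes "K > 0"
  shows "\<exists>c>0. cost 0 D c < K"
proof -
  have "((\<lambda>c. c powr (- \<alpha>)) \<longlongrightarrow> 0) at_top"
    using \<alpha> by (intro tendsto_neg_powr filterlim_ident) auto
  then have "((\<lambda>c. (1 - \<alpha>) * (c powr (- \<alpha>) * D)) \<longlongrightarrow> (1 - \<alpha>) * (0 * D)) at_top"
    by (intro tendsto_mult_left tendsto_mult_right)
  then have lim: "((\<lambda>c. cost 0 D c) \<longlongrightarrow> 0) at_top"
    by (simp add: cost_def)
  have "\<forall>\<^sub>F c in at_top. c > 0 \<and> cost 0 D c < K"
    using eventually_gt_at_top[of "0::real"] order_tendstoD(2)[OF lim assms] by eventually_elim auto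
  then show ?thesis using eventually_happens'[OF trivial_limit_at_top_linorder] by blast
qed

lemma exists_cost_less_nonpos:
  assumes "D \<le> 0" "K > 0"
  shows "\<exists>c>0. cost a D c < K"
proof -
  have lim: "((\<lambda>c. \<alpha> * (c powr (1 - \<alpha>) * a)) \<longlongrightarrow> \<alpha> * (0 * a)) (at_right 0)"
    using \<alpha> by (intro tendsto_mult_left tendsto_mult_right powr_tendsto_0_at_right) auto
  have "\<forall>\<^sub>F c in at_right 0. \<alpha> * (c powr (1 - \<alpha>) * a) < K"
    by (rule order_tendstoD(2)[OF lim]) (simp add: assms)
  then have "\<forall>\<^sub>F c in at_right 0. c > 0 \<and> cost a D c < K"
    using eventually_at_right_less
  proof eventually_elim
    case (elim c)
    have "(1 - \<alpha>) * (c powr (- \<alpha>) * D) \<le> 0"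
      using \<alpha> assms by (intro mult_nonneg_nonpos) auto
    then show ?case using elim by (simp add: cost_def)
  qed
  then show ?thesis using eventually_happens'[OF trivial_limit_at_right_real] by blast
qed

lemma exists_cost_less_neg:
  assumes D: "D < 0"
  shows "\<exists>c>0. cost a D c < - 1"
proof -
  have lim: "((\<lambda>c. \<alpha> * (c powr (1 - \<alpha>) * a)) \<longlongrightarrow> \<alpha> * (0 * a)) (at_right 0)"
    using \<alpha> by (intro tendsto_mult_left tendsto_mult_right powr_tendsto_0_at_right) auto
  have "\<forall>\<^sub>F c in at_right 0. \<alpha> * (c powr (1 - \<alpha>) * a) < 1"
    by (rule order_tendstoD(2)[OF lim]) simp
  \<comment> \<open>This threshold brings the second term of the cost below \<open>-2\<close>.\<close>
  moreover have "\<forall>\<^sub>F c in at_right 0. c powr \<alpha> < (1 - \<alpha>) * (- D) / 2"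
    using \<alpha> D by (intro order_tendstoD(2)[OF powr_tendsto_0_at_right]) (auto simp: mult_pos_neg)
  ultimately have "\<forall>\<^sub>F c in at_right 0. c > 0 \<and> cost a D c < - 1"
    using eventually_at_right_less
  proof eventually_elim
    case (elim c)
    have "(1 - \<alpha>) * (c powr (- \<alpha>) * D) = - (((1 - \<alpha>) * (- D)) / c powr \<alpha>)"
      by (simp add: powr_minus_divide)
    also have "2 < (1 - \<alpha>) * (- D) / c powr \<alpha>"
      by (subst pos_less_divide_eq) (use elim in auto)
    then have "- ((1 - \<alpha>) * (- D) / c powr \<alpha>) < - 2" by linarith
    finally show ?case using elim by (simp add: cost_def)
  qed
  then show ?thesis using eventually_happens'[OF trivial_limit_at_right_real] by blast
qed

end

section \<open>Inequalities up to o of epsilon squared\<close>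

lemma le_upto_o2I:
  assumes "\<And>e. e > 0 \<Longrightarrow> \<forall>\<^sub>F \<epsilon> in at_right 0. a \<epsilon> \<le> b \<epsilon> + \<epsilon>\<^sup>2 * e"
  shows "le_upto_o2 a b"
  unfolding le_upto_o2_def
proof (rule ereal_le_epsilon2)
  fix e :: real assume e: "e > 0"
  have "\<forall>\<^sub>F \<epsilon> in at_right 0. ereal ((a \<epsilon> - b \<epsilon>) / \<epsilon>^2) \<le> ereal e"
    using assms[OF e] eventually_at_right_less
    by eventually_elim (simp add: divide_le_eq algebra_simps)
  then show "Limsup (at_right 0) (\<lambda>\<epsilon>. ereal ((a \<epsilon> - b \<epsilon>) / \<epsilon>^2)) \<le> 0 + ereal e"
    by (simp add: Limsup_bounded)
qed

lemma not_le_upto_o2I: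
  assumes e: "e > 0" and ev: "\<forall>\<^sub>F \<epsilon> in at_right 0. b \<epsilon> + \<epsilon>\<^sup>2 * e \<le> a \<epsilon>"
  shows "\<not> le_upto_o2 a b"
proof -
  have "\<forall>\<^sub>F \<epsilon> in at_right 0. ereal e \<le> ereal ((a \<epsilon> - b \<epsilon>) / \<epsilon>^2)"
    using ev eventually_at_right_less
    by eventually_elim (simp add: le_divide_eq algebra_simps)
  then have "ereal e \<le> Liminf (at_right 0) (\<lambda>\<epsilon>. ereal ((a \<epsilon> - b \<epsilon>) / \<epsilon>^2))"
    by (rule Liminf_bounded)
  also have "\<dots> \<le> Limsup (at_right 0) (\<lambda>\<epsilon>. ereal ((a \<epsilon> - b \<epsilon>) / \<epsilon>^2))"
    by (rule Liminf_le_Limsup) simp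
  finally have "0 < Limsup (at_right 0) (\<lambda>\<epsilon>. ereal ((a \<epsilon> - b \<epsilon>) / \<epsilon>^2))"
    using e by (metis ereal_less(2) less_le_trans)
  then show ?thesis by (simp add: le_upto_o2_def not_le)
qed

lemma le_upto_o2_uminus:
  "le_upto_o2 (\<lambda>\<epsilon>. - a \<epsilon>) (\<lambda>\<epsilon>. - b \<epsilon>) \<longleftrightarrow> ge_upto_o2 a b"
proof -
  have "(\<lambda>\<epsilon>. ereal ((- a \<epsilon> - - b \<epsilon>) / \<epsilon>^2)) = (\<lambda>\<epsilon>. - ereal ((a \<epsilon> - b \<epsilon>) / \<epsilon>^2))"
    by (simp add: fun_eq_iff minus_divide_left)
  then show ?thesis
    unfolding le_upto_o2_def ge_upto_o2_def by (simp only: ereal_Limsup_uminus) simp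
qed

lemma ge_upto_o2_uminus:
  "ge_upto_o2 (\<lambda>\<epsilon>. - a \<epsilon>) (\<lambda>\<epsilon>. - b \<epsilon>) \<longleftrightarrow> le_upto_o2 a b"
  using le_upto_o2_uminus[of "\<lambda>\<epsilon>. - a \<epsilon>" "\<lambda>\<epsilon>. - b \<epsilon>"] by simp

lemma ge_upto_o2I:
  assumes "\<And>e. e > 0 \<Longrightarrow> \<forall>\<^sub>F \<epsilon> in at_right 0. b \<epsilon> - \<epsilon>\<^sup>2 * e \<le> a \<epsilon>"
  shows "ge_upto_o2 a b"
  unfolding le_upto_o2_uminus[symmetric]
  using assms by (intro le_upto_o2I) (auto simp: algebra_simps)

lemma not_ge_upto_o2I:
  assumes "e > 0" "\<forall>\<^sub>F \<epsilon> in at_right 0. a \<epsilon> \<le> b \<epsilon> - \<epsilon>\<^sup>2 * e"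
  shows "\<not> ge_upto_o2 a b"
  unfolding le_upto_o2_uminus[symmetric]
  using assms by (intro not_le_upto_o2I[of e]) (auto simp: algebra_simps)

section \<open>From the expansions to the equivalence\<close>

lemma signed_power_nonneg: "\<xi> \<ge> 0 \<Longrightarrow> signed_power p \<xi> \<ge> 0"
  by (simp add: signed_power_def)

lemma signed_power_pos: "\<xi> > 0 \<Longrightarrow> signed_power p \<xi> > 0"
  by (simp add: signed_power_def)

lemma signed_power_uminus: "signed_power p (- \<xi>) = - signed_power p \<xi>"
  by (auto simp: signed_power_def)

lemma signed_power_strict_mono:
  assumes "p > 2" "0 \<le> \<xi>" "\<xi> < \<eta>"
  shows "signed_power p \<xi> < signed_power p \<eta>"
  using assms by (simp add: signed_power_def powr_less_mono2)

context control_range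
begin

text \<open>
  The minimal cost is the signed power of the \<open>p\<close>-Laplacian because
  \<open>\<alpha> = (p - 2) / (p - 1)\<close> and \<open>1 - \<alpha> = 1 / (p - 1)\<close>.
\<close>

lemma signed_power_p_laplacian:
  assumes hess: "has_hessian \<phi> x H" and g: "grad \<phi> x \<noteq> 0"
    and D: "D = normalized_p_laplacian p H (grad \<phi> x)" "D > 0"
  shows "signed_power p (p_laplacian p \<phi> x) = norm (grad \<phi> x) powr \<alpha> * D powr (1 - \<alpha>)"
proof -
  have "p_laplacian p \<phi> x = norm (grad \<phi> x) powr (p - 2) * D"
    unfolding D(1) normalized_p_laplacian_def by (rule p_laplacian_eq[OF hess p])
  moreover have "1 - \<alpha> = 1 / (p - 1)" using p by (simp add: c_alpha_def field_simps)
  ultimately show ?thesis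
    using D(2) p by (simp add: signed_power_def powr_mult powr_powr c_alpha_def)
qed

text \<open>
  For \<open>p_laplacian p \<phi> x \<le> 0\<close> upper bounds suffice: this one decides both relations against
  \<open>F > 0\<close>, and for \<open>F = 0\<close> the strict bound in \<open>avg_plus_neg\<close> refutes the lower relation.
\<close>

lemma avg_plus_nonpos:
  assumes hess: "has_hessian \<phi> x H" and \<Delta>: "p_laplacian p \<phi> x \<le> 0" and K: "K > 0"
  shows "\<forall>\<^sub>F \<epsilon> in at_right 0. avg_plus p m M \<epsilon> \<phi> x \<le> \<phi> x + \<epsilon>\<^sup>2 * K"
proof -
  obtain D where D: "grad \<phi> x \<noteq> 0 \<Longrightarrow> D = normalized_p_laplacian p H (grad \<phi> x)"
    and mean: "\<And>e. e > 0 \<Longrightarrow> \<forall>\<^sub>F r in at_right 0. mean_op p r \<phi> x \<le> \<phi> x + r\<^sup>2 * (D + e)"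
    by (rule mean_op_upper[OF hess p]) (rule that)
  have "\<exists>c>0. cost (norm (grad \<phi> x)) D c < K"
  proof (cases "grad \<phi> x = 0")
    case True
    then show ?thesis using exists_cost_less_zero_gradient[OF K] by simp
  next
    case False
    have "norm (grad \<phi> x) powr (p - 2) * D \<le> 0"
      using \<Delta> unfolding p_laplacian_eq[OF hess p] D[OF False] normalized_p_laplacian_def .
    then have "D \<le> 0" using False by (simp add: mult_le_0_iff)
    then show ?thesis by (rule exists_cost_less_nonpos[OF _ K])
  qed
  then obtain c where "c > 0" "cost (norm (grad \<phi> x)) D c < K" by blast
  then show ?thesis by (intro avg_plus_le[OF hess mean, of c])
qed

lemma avg_plus_neg:
  assumes hess: "has_hessian \<phi> x H" and g: "grad \<phi> x \<noteq> 0" and \<Delta>: "p_laplacian p \<phi> x < 0"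
  shows "\<forall>\<^sub>F \<epsilon> in at_right 0. avg_plus p m M \<epsilon> \<phi> x \<le> \<phi> x + \<epsilon>\<^sup>2 * (- 1)"
proof -
  obtain D where D: "grad \<phi> x \<noteq> 0 \<Longrightarrow> D = normalized_p_laplacian p H (grad \<phi> x)"
    and mean: "\<And>e. e > 0 \<Longrightarrow> \<forall>\<^sub>F r in at_right 0. mean_op p r \<phi> x \<le> \<phi> x + r\<^sup>2 * (D + e)"
    by (rule mean_op_upper[OF hess p]) (rule that)
  have "norm (grad \<phi> x) powr (p - 2) * D < 0"
    using \<Delta> unfolding p_laplacian_eq[OF hess p] D[OF g] normalized_p_laplacian_def .
  then have "D < 0" using g by (simp add: mult_less_0_iff)
  then obtain c where "c > 0" "cost (norm (grad \<phi> x)) D c < - 1" using exists_cost_less_neg by blast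
  then show ?thesis by (intro avg_plus_le[OF hess mean, of c])
qed

lemma avg_plus_pos:
  assumes hess: "has_hessian \<phi> x H" and \<Delta>: "p_laplacian p \<phi> x > 0"
  shows "K > signed_power p (p_laplacian p \<phi> x) \<Longrightarrow>
      \<forall>\<^sub>F \<epsilon> in at_right 0. avg_plus p m M \<epsilon> \<phi> x \<le> \<phi> x + \<epsilon>\<^sup>2 * K"
    and "K < signed_power p (p_laplacian p \<phi> x) \<Longrightarrow>
      \<forall>\<^sub>F \<epsilon> in at_right 0. \<phi> x + \<epsilon>\<^sup>2 * K \<le> avg_plus p m M \<epsilon> \<phi> x"
proof -
  have g: "grad \<phi> x \<noteq> 0" using \<Delta> p_laplacian_eq[OF hess p] p by auto
  obtain D where "grad \<phi> x \<noteq> 0 \<Longrightarrow> D = normalized_p_laplacian p H (grad \<phi> x)"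
    and mean: "\<And>e. e > 0 \<Longrightarrow> \<forall>\<^sub>F r in at_right 0. mean_op p r \<phi> x \<le> \<phi> x + r\<^sup>2 * (D + e)"
    by (rule mean_op_upper[OF hess p]) (rule that)
  then have D: "D = normalized_p_laplacian p H (grad \<phi> x)" using g by blast
  have "norm (grad \<phi> x) powr (p - 2) * D > 0"
    using \<Delta> unfolding p_laplacian_eq[OF hess p] D normalized_p_laplacian_def .
  then have D0: "D > 0" using g by (simp add: zero_less_mult_iff)
  note J = signed_power_p_laplacian[OF hess g D D0]
  show "\<forall>\<^sub>F \<epsilon> in at_right 0. avg_plus p m M \<epsilon> \<phi> x \<le> \<phi> x + \<epsilon>\<^sup>2 * K"
    if "K > signed_power p (p_laplacian p \<phi> x)"
    using g D0 that unfolding J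
    by (intro avg_plus_le[OF hess mean, of "D / norm (grad \<phi> x)"]) (auto simp: cost_at_optimum)
  show "\<forall>\<^sub>F \<epsilon> in at_right 0. \<phi> x + \<epsilon>\<^sup>2 * K \<le> avg_plus p m M \<epsilon> \<phi> x"
    if "K < signed_power p (p_laplacian p \<phi> x)"
    using that unfolding J by (rule avg_plus_ge[OF hess g D D0])
qed

text \<open>
  If the \<open>p\<close>-Laplacian \<open>\<Delta>\<close> is positive, then the operator equals
  \<open>\<phi> x + \<epsilon>\<^sup>2 * signed_power p \<Delta> + o(\<epsilon>\<^sup>2)\<close>, and the claim is the strict monotonicity of the signed
  power. If \<open>\<Delta> \<le> 0\<close>, then the operator is at most \<open>\<phi> x + o(\<epsilon>\<^sup>2)\<close>, so the upper relation holds;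
  the lower relation fails by comparison with \<open>signed_power p F > 0\<close> if \<open>F > 0\<close>, and by \<open>\<Delta> < 0\<close>
  if \<open>F = 0\<close>.
\<close>

theorem p_laplacian_iff_avg_plus:
  assumes hess: "has_hessian \<phi> x H" and F: "F \<ge> 0"
    and nondeg: "F = 0 \<Longrightarrow> grad \<phi> x \<noteq> 0 \<and> p_laplacian p \<phi> x \<noteq> 0"
  shows "p_laplacian p \<phi> x \<le> F \<longleftrightarrow>
      le_upto_o2 (\<lambda>\<epsilon>. avg_plus p m M \<epsilon> \<phi> x) (\<lambda>\<epsilon>. \<phi> x + \<epsilon>^2 * signed_power p F)" (is ?le)
    and "p_laplacian p \<phi> x \<ge> F \<longleftrightarrow>
      ge_upto_o2 (\<lambda>\<epsilon>. avg_plus p m M \<epsilon> \<phi> x) (\<lambda>\<epsilon>. \<phi> x + \<epsilon>^2 * signed_power p F)" (is ?ge)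
proof -
  define \<Delta> where "\<Delta> = p_laplacian p \<phi> x"
  define A where "A = (\<lambda>\<epsilon>. avg_plus p m M \<epsilon> \<phi> x)"
  define J where "J = signed_power p F"
  have J: "J \<ge> 0" "F > 0 \<Longrightarrow> J > 0" using F by (auto simp: J_def signed_power_nonneg signed_power_pos)
  have "(\<Delta> \<le> F \<longleftrightarrow> le_upto_o2 A (\<lambda>\<epsilon>. \<phi> x + \<epsilon>^2 * J)) \<and> (\<Delta> \<ge> F \<longleftrightarrow> ge_upto_o2 A (\<lambda>\<epsilon>. \<phi> x + \<epsilon>^2 * J))"
  proof (cases "\<Delta> \<le> 0")
    case True
    have up: "\<forall>\<^sub>F \<epsilon> in at_right 0. A \<epsilon> \<le> \<phi> x + \<epsilon>\<^sup>2 * K" if "K > 0" for K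
      using avg_plus_nonpos[OF hess _ that] True by (simp add: \<Delta>_def A_def)
    have "le_upto_o2 A (\<lambda>\<epsilon>. \<phi> x + \<epsilon>^2 * J)"
    proof (rule le_upto_o2I)
      fix e :: real assume "e > 0"
      then show "\<forall>\<^sub>F \<epsilon> in at_right 0. A \<epsilon> \<le> \<phi> x + \<epsilon>\<^sup>2 * J + \<epsilon>\<^sup>2 * e"
        using up[of "J + e"] J(1) by (simp add: distrib_left add.assoc)
    qed
    moreover have "\<not> ge_upto_o2 A (\<lambda>\<epsilon>. \<phi> x + \<epsilon>^2 * J) \<and> \<Delta> < F"
    proof (cases "F > 0")
      case True
      have "\<forall>\<^sub>F \<epsilon> in at_right 0. A \<epsilon> \<le> \<phi> x + \<epsilon>\<^sup>2 * J - \<epsilon>\<^sup>2 * (J / 2)"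
        using up[of "J / 2"] J(2)[OF True] by (simp add: algebra_simps)
      from not_ge_upto_o2I[OF _ this] show ?thesis
        using True \<open>\<Delta> \<le> 0\<close> J(2)[OF True] by simp
    next
      case False
      then have F0: "F = 0" using F by simp
      have "\<Delta> < 0" using nondeg[OF F0] True by (simp add: \<Delta>_def)
      \<comment> \<open>For \<open>F = 0\<close> also \<open>J = 0\<close>, so any negative coefficient refutes the relation.\<close>
      have "\<forall>\<^sub>F \<epsilon> in at_right 0. A \<epsilon> \<le> \<phi> x + \<epsilon>\<^sup>2 * J - \<epsilon>\<^sup>2 * 1"
        using avg_plus_neg[OF hess] nondeg[OF F0] \<open>\<Delta> < 0\<close>
        by (simp add: \<Delta>_def A_def J_def F0 signed_power_def)
      from not_ge_upto_o2I[OF zero_less_one this] show ?thesis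
        using F0 \<open>\<Delta> < 0\<close> by simp
    qed
    ultimately show ?thesis using True F by auto
  next
    case False
    define L where "L = signed_power p \<Delta>"
    have up: "\<forall>\<^sub>F \<epsilon> in at_right 0. A \<epsilon> \<le> \<phi> x + \<epsilon>\<^sup>2 * K" if "K > L" for K
      using avg_plus_pos(1)[OF hess, of K] False that by (simp add: \<Delta>_def A_def L_def)
    have lo: "\<forall>\<^sub>F \<epsilon> in at_right 0. \<phi> x + \<epsilon>\<^sup>2 * K \<le> A \<epsilon>" if "K < L" for K
      using avg_plus_pos(2)[OF hess, of K] False that by (simp add: \<Delta>_def A_def L_def)
    have mono: "F < \<Delta> \<Longrightarrow> J < L" "\<Delta> < F \<Longrightarrow> L < J"
      using signed_power_strict_mono[OF p] F False by (auto simp: J_def L_def)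
    have "le_upto_o2 A (\<lambda>\<epsilon>. \<phi> x + \<epsilon>^2 * J)" if "L \<le> J"
    proof (rule le_upto_o2I)
      fix e :: real assume "e > 0"
      then show "\<forall>\<^sub>F \<epsilon> in at_right 0. A \<epsilon> \<le> \<phi> x + \<epsilon>\<^sup>2 * J + \<epsilon>\<^sup>2 * e"
        using up[of "J + e"] that by (simp add: distrib_left add.assoc)
    qed
    moreover have "ge_upto_o2 A (\<lambda>\<epsilon>. \<phi> x + \<epsilon>^2 * J)" if "J \<le> L"
    proof (rule ge_upto_o2I)
      fix e :: real assume "e > 0"
      then show "\<forall>\<^sub>F \<epsilon> in at_right 0. \<phi> x + \<epsilon>\<^sup>2 * J - \<epsilon>\<^sup>2 * e \<le> A \<epsilon>"
        using lo[of "J - e"] that by (simp add: right_diff_distrib add_diff_eq)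
    qed
    moreover have "\<not> le_upto_o2 A (\<lambda>\<epsilon>. \<phi> x + \<epsilon>^2 * J)" if "J < L"
    proof (rule not_le_upto_o2I[of "(L - J) / 2"])
      show "\<forall>\<^sub>F \<epsilon> in at_right 0. \<phi> x + \<epsilon>\<^sup>2 * J + \<epsilon>\<^sup>2 * ((L - J) / 2) \<le> A \<epsilon>"
      proof -
        have "J + (L - J) / 2 < L" using that by (simp add: field_simps)
        from lo[OF this] show ?thesis by (simp add: distrib_left add.assoc)
      qed
    qed (use that in simp)
    moreover have "\<not> ge_upto_o2 A (\<lambda>\<epsilon>. \<phi> x + \<epsilon>^2 * J)" if "L < J"
    proof (rule not_ge_upto_o2I[of "(J - L) / 2"])
      show "\<forall>\<^sub>F \<epsilon> in at_right 0. A \<epsilon> \<le> \<phi> x + \<epsilon>\<^sup>2 * J - \<epsilon>\<^sup>2 * ((J - L) / 2)"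
      proof -
        have "L < J - (J - L) / 2" using that by (simp add: field_simps)
        from up[OF this] show ?thesis by (simp add: right_diff_distrib add_diff_eq)
      qed
    qed (use that in simp)
    moreover have "\<Delta> = F \<Longrightarrow> L = J" by (simp add: L_def J_def)
    ultimately show ?thesis using mono by (metis less_imp_le linorder_less_linear not_le order_refl)
  qed
  then show ?le ?ge by (simp_all add: \<Delta>_def A_def J_def)
qed

end

text \<open>
  The statement for \<open>f x \<le> 0\<close> is the one for \<open>f x \<ge> 0\<close> applied to \<open>- \<phi>\<close> and \<open>- f\<close>: the change of
  sign turns \<open>avg_plus\<close> into \<open>avg_minus\<close>, and the \<open>p\<close>-Laplacian and the signed power are odd.
\<close>

lemma avg_minus_eq: "avg_minus p m M \<epsilon> \<phi> x = - avg_plus p m M \<epsilon> (\<lambda>y. - \<phi> y) x"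
  unfolding avg_minus_def avg_plus_def Let_def mean_op_uminus INF_eq_minus_SUP
  by (simp add: algebra_simps)

lemma p_laplacian_uminus:
  assumes hess: "has_hessian \<phi> x H" and p: "p > 2"
  shows "p_laplacian p (\<lambda>y. - \<phi> y) x = - p_laplacian p \<phi> x"
proof -
  interpret H: bounded_linear H using has_hessian_linear[OF hess] .
  show ?thesis
    unfolding p_laplacian_eq[OF hess p] p_laplacian_eq[OF has_hessian_uminus(2)[OF hess] p]
      has_hessian_uminus(1)[OF hess]
    by (simp add: sgn_minus H.neg sum_negf algebra_simps)
qed

theorem theorem2p3:
  fixes p R :: real
    and x :: "'a::euclidean_space"
    and \<phi> f :: "'a \<Rightarrow> real"
    and m M :: "real \<Rightarrow> real"
  assumes "p > 2"
    and "R > 0"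
    and "C_k_on 3 (ball x R) \<phi>"
    and "continuous_on (ball x R) f"
    and "f x = 0 \<Longrightarrow> grad \<phi> x \<noteq> 0 \<and> p_laplacian p \<phi> x \<noteq> 0"
    and "\<And>\<epsilon>. \<epsilon> > 0 \<Longrightarrow> m \<epsilon> = \<epsilon> powr (2 / (2 + c_alpha p))"
    and "\<And>\<epsilon>. \<epsilon> > 0 \<Longrightarrow> M \<epsilon> = \<epsilon> powr (- (2 / (2 - c_alpha p)))"
  shows
    "(f x \<ge> 0 \<longrightarrow>
        (p_laplacian p \<phi> x \<le> f x \<longleftrightarrow>
          le_upto_o2 (\<lambda>\<epsilon>. avg_plus p m M \<epsilon> \<phi> x) (\<lambda>\<epsilon>. \<phi> x + \<epsilon>^2 * signed_power p (f x))) \<and>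
        (p_laplacian p \<phi> x \<ge> f x \<longleftrightarrow>
          ge_upto_o2 (\<lambda>\<epsilon>. avg_plus p m M \<epsilon> \<phi> x) (\<lambda>\<epsilon>. \<phi> x + \<epsilon>^2 * signed_power p (f x)))) \<and>
     (f x \<le> 0 \<longrightarrow>
        (p_laplacian p \<phi> x \<le> f x \<longleftrightarrow>
          le_upto_o2 (\<lambda>\<epsilon>. avg_minus p m M \<epsilon> \<phi> x) (\<lambda>\<epsilon>. \<phi> x + \<epsilon>^2 * signed_power p (f x))) \<and>
        (p_laplacian p \<phi> x \<ge> f x \<longleftrightarrow>
          ge_upto_o2 (\<lambda>\<epsilon>. avg_minus p m M \<epsilon> \<phi> x) (\<lambda>\<epsilon>. \<phi> x + \<epsilon>^2 * signed_power p (f x))))"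
proof -
  interpret control_range p m M
    using assms(1,6,7) by unfold_locales
  obtain H where hess: "has_hessian \<phi> x H"
    using C_3_imp_has_hessian[OF assms(3,2)] by blast
  note hess' = has_hessian_uminus(2)[OF hess]
  have grad': "grad (\<lambda>y. - \<phi> y) x = - grad \<phi> x" by (rule has_hessian_uminus(1)[OF hess])
  have lap': "p_laplacian p (\<lambda>y. - \<phi> y) x = - p_laplacian p \<phi> x"
    by (rule p_laplacian_uminus[OF hess assms(1)])
  have "(p_laplacian p \<phi> x \<le> f x \<longleftrightarrow>
          le_upto_o2 (\<lambda>\<epsilon>. avg_minus p m M \<epsilon> \<phi> x) (\<lambda>\<epsilon>. \<phi> x + \<epsilon>^2 * signed_power p (f x))) \<and>
        (p_laplacian p \<phi> x \<ge> f x \<longleftrightarrow>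
          ge_upto_o2 (\<lambda>\<epsilon>. avg_minus p m M \<epsilon> \<phi> x) (\<lambda>\<epsilon>. \<phi> x + \<epsilon>^2 * signed_power p (f x)))"
    if "f x \<le> 0"
  proof -
    have rhs: "(\<lambda>\<epsilon>. - \<phi> x + \<epsilon>^2 * signed_power p (- f x)) = (\<lambda>\<epsilon>. - (\<phi> x + \<epsilon>^2 * signed_power p (f x)))"
      by (simp add: signed_power_uminus)
    have lhs: "(\<lambda>\<epsilon>. avg_plus p m M \<epsilon> (\<lambda>y. - \<phi> y) x) = (\<lambda>\<epsilon>. - avg_minus p m M \<epsilon> \<phi> x)"
      by (simp add: avg_minus_eq)
    show ?thesis
      using p_laplacian_iff_avg_plus[OF hess', of "- f x"] that assms(5)
      unfolding rhs lhs le_upto_o2_uminus ge_upto_o2_uminus lap' grad' by simp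
  qed
  moreover have "(p_laplacian p \<phi> x \<le> f x \<longleftrightarrow>
          le_upto_o2 (\<lambda>\<epsilon>. avg_plus p m M \<epsilon> \<phi> x) (\<lambda>\<epsilon>. \<phi> x + \<epsilon>^2 * signed_power p (f x))) \<and>
        (p_laplacian p \<phi> x \<ge> f x \<longleftrightarrow>
          ge_upto_o2 (\<lambda>\<epsilon>. avg_plus p m M \<epsilon> \<phi> x) (\<lambda>\<epsilon>. \<phi> x + \<epsilon>^2 * signed_power p (f x)))"
    if "f x \<ge> 0"
    using p_laplacian_iff_avg_plus[OF hess that] assms(5) by blast
  ultimately show ?thesis by blast
qed

end
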